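(* Let $\Sigma$ be a definable stratification of a definable set $V\subset\mathbb{R}^n$, let $p\in V$ lie in a stratum $S$ of $\Sigma$, and let $H$ be a linear subspace of $T_p\mathbb{R}^n\equiv\mathbb{R}^n$ such that $H+T_pS=\mathbb{R}^n$. Let $M$ be a definable smooth manifold with $\dim M\ge\dim H$. Then there exists a definable smooth map $f:M\to\mathbb{R}^n$ such that $f\pitchfork\Sigma$ and such that for some $x\in M$ one has $f(x)=p$ and $D_xf(T_xM)=H$.
   Context: Standing assumptions. Fix an o-minimal structure on the ordered field of real numbers $(\mathbb{R},<,+,\cdot,0,1)$ which is exponential (it contains the graph of the exponential function) and admits smooth ($\mathcal{C}^\infty$) cell decomposition. "Definable" means definable in this structure; "smooth" means $\mathcal{C}^\infty$. As usual $\dim\emptyset=-\infty$. A definable $\mathcal{C}^p$-submanifold of $\mathbb{R}^m$ is a definable set that is a $\mathcal{C}^p$-submanifold of $\mathbb{R}^m$. A definable smooth manifold is a definable $\mathcal{C}^\infty$-submanifold of some Euclidean space. A definable stratification of a definable set $V\subset\mathbb{R}^n$ is a partition $\Sigma$ of $V$ into finitely many definable $\mathcal{C}^1$-submanifolds of $\mathbb{R}^n$, called strata, such that for any $X,Y\in\Sigma$ with $Y\cap\overline{X}\ne\emptyset$ one has $Y\subset\overline{X}$. A map $f:M\to N$ between $\mathcal{C}^1$-manifolds is transverse to a $\mathcal{C}^1$-submanifold $S\subset N$ if for each $q\in M$ either $f(q)\notin S$ or $D_qf(T_qM)+T_{f(q)}S=T_{f(q)}N$. For a collection $\Sigma$ of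 $\mathcal{C}^1$-submanifolds, $f\pitchfork\Sigma$ means $f$ is transverse to each member of $\Sigma$. *)

theory Defs
  imports "HOL-Analysis.Analysis"
begin

text \<open>
  The definition of a structure, of a cell and of a cell decomposition has to range over all
  the spaces \<open>\<real>\<^sup>n\<close> at once, so there a point of \<open>\<real>\<^sup>n\<close> is an extensional function on
  \<open>{..<n}\<close>.  On such functions the product topology of \<^typ>\<open>nat \<Rightarrow> real\<close> is the Euclidean
  topology, the other coordinates being constant.  A structure is a family \<open>\<S>\<close>, where
  \<open>\<S> n\<close> is the set of its definable subsets of \<open>\<real>\<^sup>n\<close>.
\<close>

abbreviation Rn :: "nat \<Rightarrow> (nat \<Rightarrow> real) set" where
  "Rn n \<equiv> {..<n} \<rightarrow>\<^sub>E UNIV"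

locale definable_structure =
  fixes \<S> :: "nat \<Rightarrow> (nat \<Rightarrow> real) set set"
  assumes algebra: "algebra (Rn n) (\<S> n)"
    and times_R: "A \<in> \<S> n \<Longrightarrow> {x \<in> Rn (Suc n). restrict x {..<n} \<in> A} \<in> \<S> (Suc n)"
    and R_times: "A \<in> \<S> n \<Longrightarrow> {x \<in> Rn (Suc n). (\<lambda>i\<in>{..<n}. x (Suc i)) \<in> A} \<in> \<S> (Suc n)"
    and diagonal: "0 < n \<Longrightarrow> {x \<in> Rn n. x 0 = x (n - 1)} \<in> \<S> n"
    and projection: "A \<in> \<S> (Suc n) \<Longrightarrow> (\<lambda>x. restrict x {..<n}) ` A \<in> \<S> n"

text \<open>
  \<^const>\<open>is_interval\<close> allows every convex subset of the line (also points, rays and the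
  empty set), so the last condition is the usual one.  In particular every point is definable, i.e.
  \<open>definable\<close> always means definable with real parameters.
\<close>

locale o_minimal_structure = definable_structure +
  assumes less: "{x \<in> Rn 2. x 0 < x 1} \<in> \<S> 2"
    and plus: "{x \<in> Rn 3. x 2 = x 0 + x 1} \<in> \<S> 3"
    and times: "{x \<in> Rn 3. x 2 = x 0 * x 1} \<in> \<S> 3"
    and o_minimal: "A \<subseteq> Rn 1 \<Longrightarrow>
      A \<in> \<S> 1 \<longleftrightarrow> (\<exists>\<I>. finite \<I> \<and> (\<forall>I\<in>\<I>. is_interval I) \<and> (\<lambda>x. x 0) ` A = \<Union>\<I>)"

definition exponential :: "(nat \<Rightarrow> (nat \<Rightarrow> real) set set) \<Rightarrow> bool" where
  "exponential \<S> \<longleftrightarrow> {x \<in> Rn 2. x 1 = exp (x 0)} \<in> \<S> 2"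

definition partial :: "nat \<Rightarrow> ((nat \<Rightarrow> real) \<Rightarrow> real) \<Rightarrow> (nat \<Rightarrow> real) \<Rightarrow> real" where
  "partial i f x = deriv (\<lambda>t. f (x(i := t))) (x i)"

text \<open>Meant for relatively open subsets \<open>U\<close> of \<open>Rn n\<close>: all partial derivatives of \<open>f\<close> of
  order at most \<open>k\<close> exist and are continuous, i.e. \<open>f\<close> is of class \<open>C\<^sup>k\<close> on \<open>U\<close>.\<close>

primrec Ck_Rn :: "nat \<Rightarrow> nat \<Rightarrow> (nat \<Rightarrow> real) set \<Rightarrow> ((nat \<Rightarrow> real) \<Rightarrow> real) \<Rightarrow> bool" where
  "Ck_Rn n 0 U f \<longleftrightarrow> continuous_on U f"
| "Ck_Rn n (Suc k) U f \<longleftrightarrow> continuous_on U f \<and>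
     (\<forall>i<n. (\<forall>x\<in>U. (\<lambda>t. f (x(i := t))) differentiable (at (x i))) \<and> Ck_Rn n k U (partial i f))"

definition graph_Rn :: "nat \<Rightarrow> (nat \<Rightarrow> real) set \<Rightarrow> ((nat \<Rightarrow> real) \<Rightarrow> real) \<Rightarrow> (nat \<Rightarrow> real) set" where
  "graph_Rn n A f = {x \<in> Rn (Suc n). restrict x {..<n} \<in> A \<and> x n = f (restrict x {..<n})}"

text \<open>Definable smooth functions on a set \<open>A\<close> that need not be open are
  restrictions of definable smooth functions on an open neighbourhood of \<open>A\<close>.\<close>

definition smooth_Rn ::
  "(nat \<Rightarrow> (nat \<Rightarrow> real) set set) \<Rightarrow> nat \<Rightarrow> (nat \<Rightarrow> real) set \<Rightarrow> ((nat \<Rightarrow> real) \<Rightarrow> real) \<Rightarrow> bool" where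
  "smooth_Rn \<S> n A f \<longleftrightarrow>
     (\<exists>U F. openin (top_of_set (Rn n)) U \<and> U \<in> \<S> n \<and> A \<subseteq> U \<and>
        graph_Rn n U F \<in> \<S> (Suc n) \<and> (\<forall>k. Ck_Rn n k U F) \<and> (\<forall>x\<in>A. F x = f x))"

definition cell_bound ::
  "(nat \<Rightarrow> (nat \<Rightarrow> real) set set) \<Rightarrow> nat \<Rightarrow> (nat \<Rightarrow> real) set \<Rightarrow> ((nat \<Rightarrow> real) \<Rightarrow> ereal) \<Rightarrow> bool" where
  "cell_bound \<S> n C f \<longleftrightarrow>
     f = (\<lambda>_. -\<infinity>) \<or> f = (\<lambda>_. \<infinity>) \<or> (\<exists>g. smooth_Rn \<S> n C g \<and> f = (\<lambda>x. ereal (g x)))"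

inductive smooth_cell :: "(nat \<Rightarrow> (nat \<Rightarrow> real) set set) \<Rightarrow> nat \<Rightarrow> (nat \<Rightarrow> real) set \<Rightarrow> bool"
  for \<S> where
  point: "smooth_cell \<S> 0 (Rn 0)"
| graph: "\<lbrakk>smooth_cell \<S> n C; smooth_Rn \<S> n C f\<rbrakk> \<Longrightarrow> smooth_cell \<S> (Suc n) (graph_Rn n C f)"
| band: "\<lbrakk>smooth_cell \<S> n C; cell_bound \<S> n C f; cell_bound \<S> n C g; \<forall>x\<in>C. f x < g x\<rbrakk> \<Longrightarrow>
    smooth_cell \<S> (Suc n) {x \<in> Rn (Suc n). restrict x {..<n} \<in> C \<and>
      f (restrict x {..<n}) < ereal (x n) \<and> ereal (x n) < g (restrict x {..<n})}"

primrec smooth_decomposition ::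
  "(nat \<Rightarrow> (nat \<Rightarrow> real) set set) \<Rightarrow> nat \<Rightarrow> (nat \<Rightarrow> real) set set \<Rightarrow> bool" where
  "smooth_decomposition \<S> 0 \<D> \<longleftrightarrow> \<D> = {Rn 0}"
| "smooth_decomposition \<S> (Suc n) \<D> \<longleftrightarrow>
     finite \<D> \<and> partition_on (Rn (Suc n)) \<D> \<and> (\<forall>C\<in>\<D>. smooth_cell \<S> (Suc n) C) \<and>
     smooth_decomposition \<S> n ((\<lambda>C. (\<lambda>x. restrict x {..<n}) ` C) ` \<D>)"

definition smooth_cell_decomposition :: "(nat \<Rightarrow> (nat \<Rightarrow> real) set set) \<Rightarrow> bool" where
  "smooth_cell_decomposition \<S> \<longleftrightarrow>
     (\<forall>n \<A>. finite \<A> \<and> \<A> \<subseteq> \<S> n \<longrightarrow>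
        (\<exists>\<D>. smooth_decomposition \<S> n \<D> \<and> (\<forall>A\<in>\<A>. \<forall>C\<in>\<D>. C \<subseteq> A \<or> C \<inter> A = {}))) \<and>
     (\<forall>n A f. A \<in> \<S> n \<and> graph_Rn n A f \<in> \<S> (Suc n) \<longrightarrow>
        (\<exists>\<D>. smooth_decomposition \<S> n \<D> \<and>
           (\<forall>C\<in>\<D>. C \<subseteq> A \<or> C \<inter> A = {}) \<and> (\<forall>C\<in>\<D>. C \<subseteq> A \<longrightarrow> smooth_Rn \<S> n C f)))"

text \<open>
  A set of vectors with coordinates indexed by a finite type is definable if it becomes
  an element of the structure after the coordinates are enumerated; structures are invariant under
  permutations of coordinates, so the choice of the enumeration \<open>h\<close> does not matter.
\<close>

definition definable :: "(nat \<Rightarrow> (nat \<Rightarrow> real) set set) \<Rightarrow> (real ^ 'n) set \<Rightarrow> bool" where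
  "definable \<S> A \<longleftrightarrow>
     (\<exists>h. bij_betw h {..<CARD('n)} (UNIV :: 'n set) \<and>
        (\<lambda>x. \<lambda>i\<in>{..<CARD('n)}. x $ h i) ` A \<in> \<S> CARD('n))"

definition vec_join :: "real ^ 'm \<Rightarrow> real ^ 'n \<Rightarrow> real ^ ('m + 'n)" where
  "vec_join x y = (\<chi> k. case k of Inl i \<Rightarrow> x $ i | Inr j \<Rightarrow> y $ j)"

definition definable_map ::
  "(nat \<Rightarrow> (nat \<Rightarrow> real) set set) \<Rightarrow> (real ^ 'm) set \<Rightarrow> (real ^ 'm \<Rightarrow> real ^ 'n) \<Rightarrow> bool" where
  "definable_map \<S> A f \<longleftrightarrow> definable \<S> ((\<lambda>x. vec_join x (f x)) ` A)"

text \<open>Meant for open sets \<open>U\<close> in finite dimension, where continuity of the derivative as a map into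
  the space of linear maps is the same as continuity of its value on each vector \<open>v\<close>.\<close>

primrec Ck_on :: "nat \<Rightarrow> 'a::real_normed_vector set \<Rightarrow> ('a \<Rightarrow> 'b::real_normed_vector) \<Rightarrow> bool" where
  "Ck_on 0 U f \<longleftrightarrow> continuous_on U f"
| "Ck_on (Suc k) U f \<longleftrightarrow> (\<forall>x\<in>U. f differentiable (at x)) \<and>
     (\<forall>v. Ck_on k U (\<lambda>x. frechet_derivative f (at x) v))"

definition Cp_on :: "enat \<Rightarrow> 'a::real_normed_vector set \<Rightarrow> ('a \<Rightarrow> 'b::real_normed_vector) \<Rightarrow> bool" where
  "Cp_on p U f \<longleftrightarrow> (\<forall>k. enat k \<le> p \<longrightarrow> Ck_on k U f)"

text \<open>\<open>M\<close> is a \<open>C\<^sup>p\<close>-submanifold of dimension \<open>d\<close>: locally a \<open>C\<^sup>p\<close>-diffeomorphism of open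
  sets straightens it to a \<open>d\<close>-dimensional linear subspace.  The empty set is one for every \<open>d\<close>.\<close>

definition submanifold :: "enat \<Rightarrow> nat \<Rightarrow> 'a::euclidean_space set \<Rightarrow> bool" where
  "submanifold p d M \<longleftrightarrow>
     (\<forall>x\<in>M. \<exists>U W \<phi> \<psi> L. open U \<and> x \<in> U \<and> open W \<and> homeomorphism U W \<phi> \<psi> \<and>
        Cp_on p U \<phi> \<and> Cp_on p W \<psi> \<and> subspace L \<and> dim L = d \<and> \<phi> ` (M \<inter> U) = W \<inter> (L :: 'a set))"

definition tangent_space :: "'a::euclidean_space set \<Rightarrow> 'a \<Rightarrow> 'a set" where
  "tangent_space M x =
     {v. \<exists>\<gamma> \<epsilon>. 0 < \<epsilon> \<and> Cp_on 1 {-\<epsilon><..<\<epsilon>} \<gamma> \<and> \<gamma> ` {-\<epsilon><..<\<epsilon>} \<subseteq> M \<and> \<gamma> 0 = x \<and>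
        (\<gamma> has_vector_derivative v) (at (0::real))}"

text \<open>Smoothness on a submanifold \<open>M\<close>: locally, \<open>f\<close> extends to a smooth map on an open
  subset of the ambient space.\<close>

definition smooth_on :: "'a::euclidean_space set \<Rightarrow> ('a \<Rightarrow> 'b::euclidean_space) \<Rightarrow> bool" where
  "smooth_on M f \<longleftrightarrow>
     (\<forall>x\<in>M. \<exists>U F. open U \<and> x \<in> U \<and> Cp_on \<infinity> U F \<and> (\<forall>y\<in>M \<inter> U. F y = f y))"

text \<open>\<open>D\<^sub>xf(T\<^sub>xM)\<close>.  A derivative of \<open>f\<close> at \<open>x\<close> within \<open>M\<close> is a linear map on the ambient space.
  It is in general not unique, but its restriction to \<open>T\<^sub>xM\<close> is, and equals the differential of \<open>f\<close>.\<close>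

definition differential_image ::
  "'a::euclidean_space set \<Rightarrow> ('a \<Rightarrow> 'b::euclidean_space) \<Rightarrow> 'a \<Rightarrow> 'b set" where
  "differential_image M f x = frechet_derivative f (at x within M) ` tangent_space M x"

definition transverse ::
  "'a::euclidean_space set \<Rightarrow> ('a \<Rightarrow> 'b::euclidean_space) \<Rightarrow> 'b set \<Rightarrow> bool" where
  "transverse M f X \<longleftrightarrow>
     (\<forall>q\<in>M. f q \<notin> X \<or>
        {u + v | u v. u \<in> differential_image M f q \<and> v \<in> tangent_space X (f q)} = UNIV)"

definition definable_stratification ::
  "(nat \<Rightarrow> (nat \<Rightarrow> real) set set) \<Rightarrow> (real ^ 'n) set \<Rightarrow> (real ^ 'n) set set \<Rightarrow> bool" where
  "definable_stratification \<S> V \<Sigma> \<longleftrightarrow>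
     finite \<Sigma> \<and> partition_on V \<Sigma> \<and>
     (\<forall>X\<in>\<Sigma>. definable \<S> X \<and> (\<exists>d. submanifold 1 d X)) \<and>
     (\<forall>X\<in>\<Sigma>. \<forall>Y\<in>\<Sigma>. Y \<inter> closure X \<noteq> {} \<longrightarrow> Y \<subseteq> closure X)"

end

theory Submission
  imports Defs
begin

text \<open>
  Choose \<open>x \<in> M\<close> and a matrix \<open>A\<close> that maps the tangent space of \<open>M\<close> at \<open>x\<close> onto \<open>H\<close>.  The map
  \<open>q \<mapsto> p + A (q - x)\<close> has the required value and differential at \<open>x\<close>.  It need not be transverse to
  the strata, not even near \<open>x\<close>, because no regularity condition ties the tangent spaces of adjacent
  strata to each other.  So it is perturbed to
  \<open>f\<^sub>s(q) = p + A (q - x) + \<bar>q - x\<bar>\<^sup>2 s\<close> with a parameter \<open>s \<in> \<real>\<^sup>n\<close>, which does not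
  change the first-order behaviour at \<open>x\<close>.  At \<open>x\<close> transversality is the hypothesis on \<open>H\<close>.  At
  every other point \<open>s \<mapsto> f\<^sub>s(q)\<close> is a submersion, so a parametric transversality argument applies
  right up to \<open>x\<close>: for generic \<open>s\<close>, the polynomial map \<open>f\<^sub>s\<close> is transverse to all strata
  on \<open>M\<close> without \<open>x\<close>.

  The strata are only continuously differentiable, which is not enough for the classical theorem of Sard
  when the source has large dimension.  Genericity is therefore read off from a smooth cell decomposition
  of the space of pairs \<open>(s, q)\<close> that is compatible with the definable sets
  \<open>{(s, q). q \<in> M \<and> f\<^sub>s(q) \<in> X}\<close>.  Its projection to the space of parameters is a cell decomposition
  too, and has an open cell (\<open>smooth_decomposition_open_cell\<close>); any \<open>s\<close> in it will do.  The cells over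
  an open cell are graphs and bands stacked on each other, so straight lines in the base lift to curves
  through any given point (\<open>smooth_cell_lifts_line\<close>).  Differentiating along such curves
  gives transversality (\<open>generic_parameter\<close>).
\<close>

section \<open>Curves and tangent spaces\<close>

lemma tangent_spaceI:
  fixes \<gamma> :: "real \<Rightarrow> 'a::euclidean_space"
  assumes "0 < \<epsilon>" and deriv: "\<And>t. t \<in> {-\<epsilon><..<\<epsilon>} \<Longrightarrow> (\<gamma> has_vector_derivative \<gamma>' t) (at t)"
    and cont: "continuous_on {-\<epsilon><..<\<epsilon>} \<gamma>'"
    and "\<And>t. t \<in> {-\<epsilon><..<\<epsilon>} \<Longrightarrow> \<gamma> t \<in> M"
  shows "\<gamma>' 0 \<in> tangent_space M (\<gamma> 0)"
proof -
  let ?I = "{-\<epsilon><..<\<epsilon>}"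
  have "Ck_on 0 ?I \<gamma>"
    using has_vector_derivative_continuous[OF deriv] by (simp add: continuous_at_imp_continuous_on)
  moreover have "Ck_on 1 ?I \<gamma>"
  proof -
    have fd: "frechet_derivative \<gamma> (at t) v = v *\<^sub>R \<gamma>' t" if "t \<in> ?I" for t v
      using frechet_derivative_at[OF deriv[OF that, unfolded has_vector_derivative_def]] by metis
    have "continuous_on ?I (\<lambda>t. frechet_derivative \<gamma> (at t) v)" for v
      by (subst continuous_on_cong[OF refl fd]) (auto intro!: continuous_intros cont)
    moreover have "\<gamma> differentiable (at t)" if "t \<in> ?I" for t
      using deriv[OF that] unfolding has_vector_derivative_def differentiable_def by blast
    ultimately show ?thesis by simp
  qed
  ultimately have "Ck_on k ?I \<gamma>" if "enat k \<le> 1" for k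
    using that by (cases k) (auto simp: one_enat_def)
  then show ?thesis
    unfolding tangent_space_def Cp_on_def using assms by (auto intro!: exI[of _ \<gamma>] exI[of _ \<epsilon>])
qed

text \<open>
  A curve through \<open>x\<close> can be run backwards.
\<close>

lemma tangent_space_minus:
  assumes "v \<in> tangent_space M x" shows "- v \<in> tangent_space M x"
proof -
  obtain \<gamma> \<epsilon> where g: "0 < \<epsilon>" "Cp_on 1 {-\<epsilon><..<\<epsilon>} \<gamma>" "\<gamma> ` {-\<epsilon><..<\<epsilon>} \<subseteq> M" "\<gamma> 0 = x"
      "(\<gamma> has_vector_derivative v) (at (0::real))"
    using assms unfolding tangent_space_def by blast
  let ?I = "{-\<epsilon><..<\<epsilon>}"
  define \<gamma>' where "\<gamma>' t = frechet_derivative \<gamma> (at t) 1" for t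
  have "Ck_on (Suc 0) ?I \<gamma>" using g(2) by (auto simp: Cp_on_def one_enat_def)
  then have d: "\<And>t. t \<in> ?I \<Longrightarrow> \<gamma> differentiable (at t)" and c: "continuous_on ?I \<gamma>'"
    by (auto simp: \<gamma>'_def)
  have der: "(\<gamma> has_vector_derivative \<gamma>' t) (at t)" if "t \<in> ?I" for t
  proof -
    have D: "(\<gamma> has_derivative frechet_derivative \<gamma> (at t)) (at t)"
      using d[OF that] by (simp add: frechet_derivative_works)
    have "frechet_derivative \<gamma> (at t) r = r *\<^sub>R \<gamma>' t" for r
      unfolding \<gamma>'_def using linear_scale[OF has_derivative_linear[OF D], of r "1::real"] by simp
    then have "frechet_derivative \<gamma> (at t) = (\<lambda>r. r *\<^sub>R \<gamma>' t)" by (rule ext)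
    with D show ?thesis unfolding has_vector_derivative_def by argo
  qed
  have v: "v = \<gamma>' 0" by (rule vector_derivative_unique_at[OF g(5) der]) (use g(1) in simp)
  have "- \<gamma>' (- 0) \<in> tangent_space M (\<gamma> (- 0))"
  proof (rule tangent_spaceI[where \<gamma> = "\<lambda>t. \<gamma> (- t)" and \<gamma>' = "\<lambda>t. - \<gamma>' (- t)"])
    show "((\<lambda>t. \<gamma> (- t)) has_vector_derivative - \<gamma>' (- t)) (at t)" if "t \<in> ?I" for t
    proof -
      have "(uminus has_vector_derivative - 1) (at t)"
        by (auto intro!: derivative_eq_intros)
      from vector_diff_chain_at[OF this der[of "-t"]] that show ?thesis by (simp add: o_def)
    qed
    show "continuous_on ?I (\<lambda>t. - \<gamma>' (- t))"
      by (intro continuous_intros continuous_on_compose2[OF c]) auto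
  qed (use g in \<open>auto simp: image_subset_iff\<close>)
  then show ?thesis using v g by simp
qed

text \<open>
  The derivative within \<open>M\<close> is an arbitrary choice off the tangent space.  On a tangent vector it
  is determined by the derivative of \<open>f\<close> along a curve in \<open>M\<close>, and there it has to agree with the
  derivative of \<open>f\<close> in the ambient space.
\<close>

lemma differential_image_eq:
  fixes f :: "'a::euclidean_space \<Rightarrow> 'b::euclidean_space"
  assumes f: "(f has_derivative f') (at x)"
  shows "differential_image M f x = f' ` tangent_space M x"
proof -
  let ?D = "frechet_derivative f (at x within M)"
  have D: "(f has_derivative ?D) (at x within M)"
    using f has_derivative_at_withinI frechet_derivative_works differentiableI by blast
  have "?D v = f' v" if "v \<in> tangent_space M x" for v
  proof -
    obtain \<gamma> \<epsilon> where g: "0 < \<epsilon>" "\<gamma> ` {-\<epsilon><..<\<epsilon>} \<subseteq> M" "\<gamma> 0 = x"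
        "(\<gamma> has_vector_derivative v) (at (0::real))"
      using \<open>v \<in> _\<close> unfolding tangent_space_def by blast
    have at: "at 0 within {-\<epsilon><..<\<epsilon>} = at (0::real)"
      by (rule at_within_open) (use g(1) in auto)
    have g': "(\<gamma> has_derivative (\<lambda>r. r *\<^sub>R v)) (at 0)"
      using g(4) by (simp only: has_vector_derivative_def)
    have "(f has_derivative ?D) (at (\<gamma> 0) within \<gamma> ` {-\<epsilon><..<\<epsilon>})"
      unfolding g(3) by (rule has_derivative_subset[OF D g(2)])
    from diff_chain_within[OF g'[folded at] this]
    have "(f \<circ> \<gamma> has_derivative ?D \<circ> (\<lambda>r. r *\<^sub>R v)) (at 0)" unfolding at .
    moreover have "(f \<circ> \<gamma> has_derivative f' \<circ> (\<lambda>r. r *\<^sub>R v)) (at 0)"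
      by (rule diff_chain_at[OF g']) (use f g(3) in simp)
    ultimately have "?D \<circ> (\<lambda>r. r *\<^sub>R v) = f' \<circ> (\<lambda>r. r *\<^sub>R v)"
      by (rule has_derivative_unique)
    then show ?thesis by (metis comp_apply scaleR_one)
  qed
  then show ?thesis unfolding differential_image_def by auto
qed

lemma has_vector_derivative_quotient:
  fixes f :: "real \<Rightarrow> 'a::real_normed_vector"
  assumes "(f has_vector_derivative v) (at a)"
  shows "((\<lambda>t. (1 / (t - a)) *\<^sub>R (f t - f a)) \<longlongrightarrow> v) (at a)"
proof -
  let ?r = "\<lambda>t. (1 / norm (t - a)) *\<^sub>R (f t - (f a + (t - a) *\<^sub>R v))"
  have "(?r \<longlongrightarrow> 0) (at a)"
    using assms by (simp add: has_vector_derivative_def has_derivative_within)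
  then have "((\<lambda>t. norm (?r t)) \<longlongrightarrow> 0) (at a)" by (rule tendsto_norm_zero)
  moreover have "norm (?r t) = norm ((1 / (t - a)) *\<^sub>R (f t - f a) - v)" if "t \<noteq> a" for t
  proof -
    have "(1 / (t - a)) *\<^sub>R (f t - f a) - v = (1 / (t - a)) *\<^sub>R (f t - (f a + (t - a) *\<^sub>R v))"
      using that by (simp add: scaleR_diff_right diff_diff_eq[symmetric])
    then show ?thesis by simp
  qed
  then have "\<forall>\<^sub>F t in at a. norm (?r t) = norm ((1 / (t - a)) *\<^sub>R (f t - f a) - v)"
    by (simp only: eventually_at_filter) simp
  ultimately have "((\<lambda>t. norm ((1 / (t - a)) *\<^sub>R (f t - f a) - v)) \<longlongrightarrow> 0) (at a)"
    by (rule Lim_transform_eventually)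
  then have "((\<lambda>t. (1 / (t - a)) *\<^sub>R (f t - f a) - v) \<longlongrightarrow> 0) (at a)"
    by (rule tendsto_norm_zero_cancel)
  then show ?thesis by (simp add: LIM_zero_iff)
qed

text \<open>
  In a chart \<open>\<phi>\<close> with inverse \<open>\<psi>\<close> the manifold is a linear subspace \<open>L\<close>, and curves in \<open>M\<close> are the
  images under \<open>\<psi>\<close> of curves in \<open>L\<close>.  Hence the tangent space is the image of \<open>L\<close> under the
  derivative of \<open>\<psi>\<close>, which is injective.
\<close>

lemma tangent_space_submanifold:
  fixes M :: "'a::euclidean_space set"
  assumes "submanifold p d M" and "1 \<le> p" and "x \<in> M"
  shows "subspace (tangent_space M x) \<and> dim (tangent_space M x) = d"
proof -
  obtain U W \<phi> \<psi> L where U: "open U" "x \<in> U" and W: "open W" and hom: "homeomorphism U W \<phi> \<psi>"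
    and \<phi>: "Cp_on p U \<phi>" and \<psi>: "Cp_on p W \<psi>" and L: "subspace (L::'a set)" "dim L = d"
    and str: "\<phi> ` (M \<inter> U) = W \<inter> L"
    using assms(1,3) unfolding submanifold_def by meson
  have le: "enat (Suc 0) \<le> p" using assms(2) by (simp add: one_enat_def)
  have \<psi>C: "\<And>y. y \<in> W \<Longrightarrow> \<psi> differentiable (at y)"
      "\<And>v. continuous_on W (\<lambda>y. frechet_derivative \<psi> (at y) v)"
    using \<psi> le unfolding Cp_on_def by fastforce+
  have \<phi>C: "\<phi> differentiable (at x)" using \<phi> le U unfolding Cp_on_def by fastforce
  define D where "D = frechet_derivative \<psi> (at (\<phi> x))"
  define E where "E = frechet_derivative \<phi> (at x)"
  have xW: "\<phi> x \<in> W" using hom U by (auto simp: homeomorphism_def)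
  have D: "(\<psi> has_derivative D) (at (\<phi> x))" using \<psi>C(1)[OF xW] frechet_derivative_works D_def by blast
  have E: "(\<phi> has_derivative E) (at x)" using \<phi>C frechet_derivative_works E_def by blast
  have inv: "\<psi> (\<phi> y) = y" if "y \<in> U" for y using hom that by (auto simp: homeomorphism_def)
  have inv': "\<phi> (\<psi> y) = y" "\<psi> y \<in> U" if "y \<in> W" for y using hom that by (auto simp: homeomorphism_def)
  have DE: "D (E v) = v" for v
  proof -
    have "(\<psi> \<circ> \<phi> has_derivative D \<circ> E) (at x)" by (rule diff_chain_at[OF E D])
    then have "((\<lambda>y. y) has_derivative D \<circ> E) (at x)"
      by (rule has_derivative_transform_within_open[OF _ U]) (simp add: inv)
    then have "D \<circ> E = (\<lambda>v. v)" using has_derivative_unique has_derivative_ident by blast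
    then show ?thesis by (metis comp_apply)
  qed
  have ED: "E (D v) = v" for v
  proof -
    have "(\<phi> \<circ> \<psi> has_derivative E \<circ> D) (at (\<phi> x))"
      by (rule diff_chain_at[OF D]) (simp add: inv U E)
    then have "((\<lambda>y. y) has_derivative E \<circ> D) (at (\<phi> x))"
      by (rule has_derivative_transform_within_open[OF _ W xW]) (simp add: inv')
    then have "E \<circ> D = (\<lambda>v. v)" using has_derivative_unique has_derivative_ident by blast
    then show ?thesis by (metis comp_apply)
  qed
  have linD: "linear D" using D has_derivative_linear by blast
  have \<phi>xL: "\<phi> x \<in> L" using str assms(3) U by auto
  have "tangent_space M x = D ` L"
  proof (intro equalityI subsetI)
    fix v assume "v \<in> tangent_space M x"
    then obtain \<gamma> \<epsilon> where g: "0 < \<epsilon>" "\<gamma> ` {-\<epsilon><..<\<epsilon>} \<subseteq> M" "\<gamma> 0 = x"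
        "(\<gamma> has_vector_derivative v) (at (0::real))"
      unfolding tangent_space_def by blast
    have "(\<gamma> \<longlongrightarrow> x) (at 0)"
      using has_vector_derivative_continuous[OF g(4)] g(3) by (simp add: continuous_at)
    then have "\<forall>\<^sub>F t in at 0. \<gamma> t \<in> U" using U topological_tendstoD by blast
    moreover have "\<forall>\<^sub>F t in at 0. t \<in> {-\<epsilon><..<\<epsilon>}"
      by (rule eventually_at_in_open') (use g in auto)
    moreover have "\<phi> (\<gamma> t) \<in> L" if "\<gamma> t \<in> U" "t \<in> {-\<epsilon><..<\<epsilon>}" for t
    proof -
      have "\<gamma> t \<in> M \<inter> U" using that g(2) by blast
      then have "\<phi> (\<gamma> t) \<in> \<phi> ` (M \<inter> U)" by (rule imageI)
      then show ?thesis using str by simp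
    qed
    ultimately have ev: "\<forall>\<^sub>F t in at 0. \<phi> (\<gamma> t) \<in> L"
      by (blast intro: eventually_elim2)
    have "(\<phi> \<circ> \<gamma> has_vector_derivative E v) (at 0)"
      by (rule vector_derivative_diff_chain_within[OF g(4)])
        (use has_derivative_at_withinI[OF E] g(3) in simp)
    then have "((\<lambda>t. (1 / t) *\<^sub>R (\<phi> (\<gamma> t) - \<phi> x)) \<longlongrightarrow> E v) (at 0)"
      using has_vector_derivative_quotient[of "\<phi> \<circ> \<gamma>" "E v" 0] g(3) by (simp add: o_def)
    moreover have "\<forall>\<^sub>F t in at 0. (1 / t) *\<^sub>R (\<phi> (\<gamma> t) - \<phi> x) \<in> L"
      using ev by eventually_elim (intro subspace_scale subspace_diff L \<phi>xL)
    \<comment> \<open>The difference quotients lie in \<open>L\<close>, which is closed.\<close>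
    ultimately have "E v \<in> L"
      using Lim_in_closed_set[OF closed_subspace[OF L(1)]] by (metis trivial_limit_at)
    then show "v \<in> D ` L" using DE[of v] by (metis image_eqI)
  next
    fix v assume "v \<in> D ` L"
    then obtain l where l: "l \<in> L" "v = D l" by blast
    have "open ((\<lambda>t. \<phi> x + t *\<^sub>R l) -` W)"
      by (intro open_vimage W continuous_intros)
    moreover have "0 \<in> (\<lambda>t. \<phi> x + t *\<^sub>R l) -` W" using xW by simp
    ultimately obtain \<epsilon> where e: "0 < \<epsilon>" "ball (0::real) \<epsilon> \<subseteq> (\<lambda>t. \<phi> x + t *\<^sub>R l) -` W"
      using openE by blast
    have inW: "\<phi> x + t *\<^sub>R l \<in> W" if "t \<in> {-\<epsilon><..<\<epsilon>}" for t
      using e(2) that by (auto simp: ball_eq_greaterThanLessThan)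
    have "frechet_derivative \<psi> (at (\<phi> x + 0 *\<^sub>R l)) l \<in> tangent_space M (\<psi> (\<phi> x + 0 *\<^sub>R l))"
    proof (rule tangent_spaceI[where \<gamma> = "\<lambda>t. \<psi> (\<phi> x + t *\<^sub>R l)" and \<epsilon> = \<epsilon>
          and \<gamma>' = "\<lambda>t. frechet_derivative \<psi> (at (\<phi> x + t *\<^sub>R l)) l"])
      fix t assume t: "t \<in> {-\<epsilon><..<\<epsilon>}"
      have P: "(\<psi> has_derivative frechet_derivative \<psi> (at (\<phi> x + t *\<^sub>R l))) (at (\<phi> x + t *\<^sub>R l))"
        using \<psi>C(1)[OF inW[OF t]] frechet_derivative_works by blast
      have "((\<lambda>t. \<phi> x + t *\<^sub>R l) has_vector_derivative l) (at t)"
        by (auto intro!: derivative_eq_intros simp: has_vector_derivative_def)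
      from vector_derivative_diff_chain_within[OF this has_derivative_at_withinI[OF P]]
      show "((\<lambda>t. \<psi> (\<phi> x + t *\<^sub>R l)) has_vector_derivative
          frechet_derivative \<psi> (at (\<phi> x + t *\<^sub>R l)) l) (at t)"
        by (simp add: o_def)
      have "\<phi> x + t *\<^sub>R l \<in> W \<inter> L"
        using inW[OF t] L l \<phi>xL by (auto intro: subspace_add subspace_scale)
      then obtain y where "y \<in> M \<inter> U" "\<phi> y = \<phi> x + t *\<^sub>R l" using str by (metis imageE)
      then show "\<psi> (\<phi> x + t *\<^sub>R l) \<in> M" using inv by (metis IntE)
    next
      show "continuous_on {-\<epsilon><..<\<epsilon>} (\<lambda>t. frechet_derivative \<psi> (at (\<phi> x + t *\<^sub>R l)) l)"
        by (rule continuous_on_compose2[OF \<psi>C(2)]) (auto intro!: continuous_intros inW)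
    qed fact
    then show "v \<in> tangent_space M x" using inv U l by (simp add: D_def)
  qed
  moreover have "inj D" by (metis ED injI)
  ultimately show ?thesis
    using L linD by (metis dim_image_eq linear_subspace_image inj_on_subset subset_UNIV)
qed

lemma linear_map_onto_subspace:
  fixes T :: "'a::euclidean_space set" and H :: "'b::euclidean_space set"
  assumes "subspace T" and "subspace H" and "dim H \<le> dim T"
  obtains g where "linear g" and "g ` T = H"
proof -
  obtain B where B: "B \<subseteq> T" "independent B" "span B = T" "card B = dim T"
    using basis_subspace_exists[OF assms(1)] by metis
  obtain C where C: "C \<subseteq> H" "independent C" "span C = H" "card C = dim H"
    using basis_subspace_exists[OF assms(2)] by metis
  have fin: "finite B" "finite C" using B(2) C(2) by (auto intro: independent_imp_finite)
  obtain \<iota> where i: "\<iota> ` C \<subseteq> B" "inj_on \<iota> C"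
    using card_le_inj[OF fin(2,1)] B(4) C(4) assms(3) by auto
  obtain g where g: "linear g" "\<And>b. b \<in> B \<Longrightarrow> g b = (if b \<in> \<iota> ` C then inv_into C \<iota> b else 0)"
    using linear_independent_extend[OF B(2), of "\<lambda>b. if b \<in> \<iota> ` C then inv_into C \<iota> b else 0"] by blast
  have "C \<subseteq> g ` B" 
  proof
    fix c assume "c \<in> C"
    then have "\<iota> c \<in> B" "g (\<iota> c) = c" using g(2)[of "\<iota> c"] i by auto
    then show "c \<in> g ` B" by (metis imageI)
  qed
  moreover have "g ` B \<subseteq> insert 0 C" using g(2) inv_into_into[of _ \<iota> C] by auto
  ultimately have "span (g ` B) = span C"
    using span_mono[of C "g ` B"] span_mono[of "g ` B" "insert 0 C"] span_insert_0[of C] by blast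
  then have "g ` T = H" using linear_span_image[OF g(1)] B C by simp
  with g that show ?thesis by blast
qed

lemma has_vector_derivative_vec:
  fixes f :: "real \<Rightarrow> real ^ 'n"
  assumes "\<And>j. ((\<lambda>t. f t $ j) has_real_derivative f' $ j) (at t)"
  shows "(f has_vector_derivative f') (at t)"
  unfolding has_vector_derivative_def
proof (subst has_derivative_componentwise_within, rule ballI)
  fix b :: "real ^ 'n" assume "b \<in> Basis"
  then obtain j where b: "b = axis j 1" by (auto simp: Basis_vec_def)
  show "((\<lambda>t. f t \<bullet> b) has_derivative (\<lambda>r. (r *\<^sub>R f') \<bullet> b)) (at t)"
    using assms[of j] by (simp add: b inner_axis has_field_derivative_def mult.commute[of _ "f' $ j"])
qed

section \<open>The quadratic family\<close>

lemma Ck_on_const: "Ck_on k U (\<lambda>x. c)"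
  by (induction k arbitrary: c) (auto simp: frechet_derivative_const)

lemma Ck_on_UNIV_derivative:
  assumes "\<And>x. (f has_derivative f' x) (at x)" and "\<And>v. Ck_on k UNIV (\<lambda>x. f' x v)"
  shows "Ck_on (Suc k) UNIV f"
proof -
  have "frechet_derivative f (at x) = f' x" for x
    using assms(1) frechet_derivative_at by metis
  then show ?thesis using assms by (auto simp: differentiable_def)
qed

lemma Ck_on_affine:
  assumes "bounded_linear l" shows "Ck_on k UNIV (\<lambda>x. c + l x)"
proof (cases k)
  case 0
  then show ?thesis
    using assms by (auto intro!: continuous_intros simp: linear_continuous_on)
next
  case (Suc k')
  have "((\<lambda>x. c + l x) has_derivative l) (at x)" for x
    using bounded_linear_imp_has_derivative[OF assms] by (auto intro!: derivative_eq_intros)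
  then show ?thesis unfolding Suc by (rule Ck_on_UNIV_derivative) (rule Ck_on_const)
qed

text \<open>
  The perturbations of the affine map with linear part \<open>A\<close>.  The factor \<open>\<bar>q - x\<bar>\<^sup>2\<close> keeps the value
  and the derivative at \<open>x\<close> independent of \<open>s\<close>, but for every other \<open>q\<close> the map \<open>s \<mapsto> quadratic_map p A x s q\<close>
  is a submersion.
\<close>

definition quadratic_map :: "real^'n \<Rightarrow> real^'m^'n \<Rightarrow> real^'m \<Rightarrow> real^'n \<Rightarrow> real^'m \<Rightarrow> real^'n" where
  "quadratic_map p A x s q = p + A *v (q - x) + ((q - x) \<bullet> (q - x)) *\<^sub>R s"

lemma quadratic_map_has_derivative:
  "(quadratic_map p A x s has_derivative (\<lambda>u. A *v u + (2 * ((q - x) \<bullet> u)) *\<^sub>R s)) (at q)"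
proof -
  have A: "((\<lambda>q. A *v (q - x)) has_derivative (\<lambda>u. A *v u)) (at q)"
    by (rule bounded_linear.has_derivative[OF matrix_vector_mul_bounded_linear[of A],
        of "\<lambda>q. q - x" "\<lambda>u. u" "at q"]) (auto intro!: derivative_eq_intros)
  show ?thesis unfolding quadratic_map_def
    by (rule has_derivative_eq_rhs, (rule derivative_intros A)+) (simp add: inner_commute)
qed

text \<open>
  The derivative in a fixed direction is an affine function of the point, whose derivative is constant.
\<close>

lemma quadratic_map_Cp: "Cp_on \<infinity> UNIV (quadratic_map p A x s)"
proof -
  have "Ck_on k UNIV (quadratic_map p A x s)" for k
  proof (cases k)
    case 0
    have "isCont (quadratic_map p A x s) q" for q
      using quadratic_map_has_derivative has_derivative_continuous by blast
    with 0 show ?thesis by (simp add: continuous_on_eq_continuous_at)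
  next
    case (Suc k')
    have "Ck_on k' UNIV (\<lambda>q. A *v u + (2 * ((q - x) \<bullet> u)) *\<^sub>R s)" for u
    proof -
      have "Ck_on k' UNIV (\<lambda>q. (A *v u - (2 * (x \<bullet> u)) *\<^sub>R s) + (2 * (q \<bullet> u)) *\<^sub>R s)"
        by (rule Ck_on_affine) (intro bounded_linear_scaleR_const 
              bounded_linear_mult_right[THEN bounded_linear_compose] bounded_linear_inner_left)
      then show ?thesis by (simp add: algebra_simps inner_diff_left)
    qed
    with quadratic_map_has_derivative show ?thesis unfolding Suc by (rule Ck_on_UNIV_derivative)
  qed
  then show ?thesis by (simp add: Cp_on_def)
qed

lemma quadratic_family_derivative:
  assumes Q: "(Q has_vector_derivative Q') (at t)"
  shows "((\<lambda>t. quadratic_map p A x (s + t *\<^sub>R w) (Q t)) has_vector_derivative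
      A *v Q' + (2 * ((Q t - x) \<bullet> Q')) *\<^sub>R (s + t *\<^sub>R w) + ((Q t - x) \<bullet> (Q t - x)) *\<^sub>R w) (at t)"
proof -
  have Q: "(Q has_derivative (\<lambda>r. r *\<^sub>R Q')) (at t)" using Q by (simp only: has_vector_derivative_def)
  have D: "((\<lambda>t. Q t - x) has_derivative (\<lambda>r. r *\<^sub>R Q')) (at t)"
    using has_derivative_diff[OF Q has_derivative_const[of x]] by simp
  have AQ: "((\<lambda>t. A *v (Q t - x)) has_derivative (\<lambda>r. A *v (r *\<^sub>R Q'))) (at t)"
    by (rule bounded_linear.has_derivative[OF matrix_vector_mul_bounded_linear D])
  show ?thesis
    unfolding has_vector_derivative_def quadratic_map_def
    by (rule has_derivative_eq_rhs, (rule AQ D derivative_intros)+)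
      (simp add: inner_commute scaleR_add_right scaleR_add_left matrix_vector_mult_scaleR fun_eq_iff
        mult.assoc mult.commute mult.left_commute)
qed

section \<open>Definable sets and functions\<close>

context definable_structure
begin

lemma definable_subset: "A \<in> \<S> n \<Longrightarrow> A \<subseteq> Rn n"
  using algebra[of n] by (auto simp: algebra_iff_Un)

lemma definable_Int: "A \<in> \<S> n \<Longrightarrow> B \<in> \<S> n \<Longrightarrow> A \<inter> B \<in> \<S> n"
  using algebra[of n] by (auto simp: algebra_iff_Int)

lemma definable_Rn: "Rn n \<in> \<S> n"
  using algebra.top[OF algebra] by blast

lemma definable_Ball:
  assumes "finite I" and "\<And>i. i \<in> I \<Longrightarrow> {x \<in> Rn n. P i x} \<in> \<S> n"
  shows "{x \<in> Rn n. \<forall>i\<in>I. P i x} \<in> \<S> n"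
  using assms
proof (induction I)
  case empty
  then show ?case using definable_Rn by simp
next
  case (insert i I)
  have "{x \<in> Rn n. \<forall>i\<in>insert i I. P i x} = {x \<in> Rn n. P i x} \<inter> {x \<in> Rn n. \<forall>i\<in>I. P i x}" by auto
  then show ?case using insert by (simp add: definable_Int)
qed

lemma definable_cylinder:
  assumes "A \<in> \<S> n" and "n \<le> N" shows "{x \<in> Rn N. restrict x {..<n} \<in> A} \<in> \<S> N"
  using assms(2)
proof (induction N rule: dec_induct)
  case base
  have "{x \<in> Rn n. restrict x {..<n} \<in> A} = A"
    using definable_subset[OF assms(1)] by auto
  then show ?case using assms by argo
next
  case (step N)
  have "{x \<in> Rn (Suc N). restrict x {..<N} \<in> {x \<in> Rn N. restrict x {..<n} \<in> A}} =
      {x \<in> Rn (Suc N). restrict x {..<n} \<in> A}"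
    using step(1) by (auto simp: Int_absorb1)
  then show ?case using times_R[OF step.IH] by argo
qed

lemma definable_left_cylinder:
  assumes "A \<in> \<S> n" shows "{x \<in> Rn (k + n). (\<lambda>i\<in>{..<n}. x (k + i)) \<in> A} \<in> \<S> (k + n)"
proof (induction k)
  case 0
  have "{x \<in> Rn n. (\<lambda>i\<in>{..<n}. x i) \<in> A} = A"
    using definable_subset[OF assms(1)] by auto
  then show ?case using assms by (simp only: add_0)
next
  case (Suc k)
  have *: "(\<lambda>i\<in>{..<n}. (\<lambda>i\<in>{..<k + n}. x (Suc i)) (k + i)) = (\<lambda>i\<in>{..<n}. x (Suc k + i))"
    for x :: "nat \<Rightarrow> real"
    by (rule restrict_ext) auto
  have "{x \<in> Rn (Suc (k + n)). (\<lambda>i\<in>{..<k + n}. x (Suc i)) \<in>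
        {x \<in> Rn (k + n). (\<lambda>i\<in>{..<n}. x (k + i)) \<in> A}} =
      {x \<in> Rn (Suc k + n). (\<lambda>i\<in>{..<n}. x (Suc k + i)) \<in> A}"
    unfolding mem_Collect_eq * by auto
  with R_times[OF Suc] show ?case by (simp only: add_Suc)
qed

lemma definable_diagonal:
  assumes "a < N" and "b < N" shows "{x \<in> Rn N. x a = x b} \<in> \<S> N"
proof -
  have main: "{x \<in> Rn N. x a = x b} \<in> \<S> N" if "a \<le> b" "b < N" for a b
  proof -
    define k where "k = Suc (b - a)"
    have "{x \<in> Rn k. x 0 = x (k - 1)} \<in> \<S> k" using diagonal[of k] by (simp add: k_def)
    from definable_left_cylinder[OF this, of a]
    have "{x \<in> Rn (a + k). x a = x (a + (k - 1))} \<in> \<S> (a + k)" by (simp add: k_def)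
    then have "{x \<in> Rn (Suc b). x a = x b} \<in> \<S> (Suc b)" using that by (simp add: k_def)
    from definable_cylinder[OF this, of N] that show ?thesis by (simp add: le_imp_less_Suc)
  qed
  show ?thesis
  proof (cases "a \<le> b")
    case True then show ?thesis using main assms by blast
  next
    case False
    then have "{x \<in> Rn N. x b = x a} \<in> \<S> N" using main assms by simp
    then show ?thesis by (simp add: eq_commute)
  qed
qed

lemma definable_projection:
  assumes "A \<in> \<S> N" and "n \<le> N" shows "(\<lambda>x. restrict x {..<n}) ` A \<in> \<S> n"
  using assms(2,1)
proof (induction N arbitrary: A rule: dec_induct)
  case base
  have "(\<lambda>x. restrict x {..<n}) ` A = A"
    using definable_subset[OF base] by force
  then show ?case using base by argo
next
  case (step N)
  have "(\<lambda>x. restrict x {..<n}) ` (\<lambda>x. restrict x {..<N}) ` A = (\<lambda>x. restrict x {..<n}) ` A"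
    using step(1) by (simp add: image_image Int_absorb1)
  then show ?case using step.IH[OF projection[OF step.prems]] by argo
qed

text \<open>
  The preimage of \<open>X\<close> under the map with components \<open>P i\<close> is the projection of the part of its graph
  that lies over \<open>X\<close>.  The assumption speaks about the components in the space of the graph, so that the
  lemma applies to coordinate functions before definable functions are closed under adding variables.
\<close>

lemma definable_preimage_of_graphs:
  assumes X: "X \<in> \<S> k" and P: "\<And>i. i < k \<Longrightarrow> {z \<in> Rn (N + k). z (N + i) = P i (restrict z {..<N})} \<in> \<S> (N + k)"
  shows "{x \<in> Rn N. (\<lambda>i\<in>{..<k}. P i x) \<in> X} \<in> \<S> N"
proof -
  let ?B = "{z \<in> Rn (N + k). (\<lambda>i\<in>{..<k}. z (N + i)) \<in> X} \<inter>
      {z \<in> Rn (N + k). \<forall>i\<in>{..<k}. z (N + i) = P i (restrict z {..<N})}"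
  have "?B \<in> \<S> (N + k)"
    by (intro definable_Int definable_left_cylinder X definable_Ball) (auto simp: P)
  then have "(\<lambda>x. restrict x {..<N}) ` ?B \<in> \<S> N" by (rule definable_projection) simp
  moreover have "(\<lambda>x. restrict x {..<N}) ` ?B = {x \<in> Rn N. (\<lambda>i\<in>{..<k}. P i x) \<in> X}"
  proof (intro equalityI subsetI)
    fix x assume "x \<in> (\<lambda>x. restrict x {..<N}) ` ?B"
    then obtain z where z: "z \<in> ?B" "x = restrict z {..<N}" by blast
    then have "(\<lambda>i\<in>{..<k}. P i x) = (\<lambda>i\<in>{..<k}. z (N + i))" by (intro restrict_ext) auto
    with z show "x \<in> {x \<in> Rn N. (\<lambda>i\<in>{..<k}. P i x) \<in> X}" by auto
  next
    fix x assume x: "x \<in> {x \<in> Rn N. (\<lambda>i\<in>{..<k}. P i x) \<in> X}"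
    define z where "z = (\<lambda>i\<in>{..<N + k}. if i < N then x i else P (i - N) x)"
    have r: "restrict z {..<N} = x"
      using x by (auto simp: z_def restrict_def PiE_def extensional_def)
    have "(\<lambda>i\<in>{..<k}. z (N + i)) = (\<lambda>i\<in>{..<k}. P i x)"
      by (rule restrict_ext) (auto simp: z_def)
    moreover have "z (N + i) = P i x" if "i < k" for i using that by (simp add: z_def)
    moreover have "z \<in> Rn (N + k)" by (auto simp: z_def)
    ultimately have "z \<in> ?B" using x r by simp
    then show "x \<in> (\<lambda>x. restrict x {..<N}) ` ?B" by (intro image_eqI[of x _ z] r[symmetric])
  qed
  ultimately show ?thesis by (simp only:)
qed

text \<open>
  Permuting, repeating and omitting coordinates all preserve definability.
\<close>

lemma definable_substitution:
  assumes "X \<in> \<S> k" and "\<And>i. i < k \<Longrightarrow> \<tau> i < N"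
  shows "{x \<in> Rn N. (\<lambda>i\<in>{..<k}. x (\<tau> i)) \<in> X} \<in> \<S> N"
proof (rule definable_preimage_of_graphs[OF assms(1)])
  fix i assume "i < k"
  then show "{z \<in> Rn (N + k). z (N + i) = restrict z {..<N} (\<tau> i)} \<in> \<S> (N + k)"
    using definable_diagonal[of "N + i" "N + k" "\<tau> i"] assms(2)[of i] by simp
qed

definition definable_fun :: "nat \<Rightarrow> ((nat \<Rightarrow> real) \<Rightarrow> real) \<Rightarrow> bool" where
  "definable_fun n P \<longleftrightarrow> {x \<in> Rn (Suc n). x n = P (restrict x {..<n})} \<in> \<S> (Suc n)"

lemma definable_preimage:
  assumes "X \<in> \<S> k" and "\<And>i. i < k \<Longrightarrow> definable_fun N (P i)"
  shows "{x \<in> Rn N. (\<lambda>i\<in>{..<k}. P i x) \<in> X} \<in> \<S> N"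
proof (rule definable_preimage_of_graphs[OF assms(1)])
  fix i assume i: "i < k"
  \<comment> \<open>\<open>\<tau>\<close> picks out the variables of the graph of \<open>P i\<close> among those of the graph of the whole map.\<close>
  let ?\<tau> = "\<lambda>j. if j < N then j else N + i"
  have r: "restrict (\<lambda>j\<in>{..<Suc N}. z (?\<tau> j)) {..<N} = restrict z {..<N}" for z :: "nat \<Rightarrow> real"
    by (rule ext) simp
  have "{z \<in> Rn (N + k). (\<lambda>j\<in>{..<Suc N}. z (?\<tau> j)) \<in>
      {x \<in> Rn (Suc N). x N = P i (restrict x {..<N})}} \<in> \<S> (N + k)"
    by (rule definable_substitution) (use assms(2)[OF i] i in \<open>auto simp: definable_fun_def\<close>)
  moreover have "(\<lambda>j\<in>{..<Suc N}. z (?\<tau> j)) \<in> {x \<in> Rn (Suc N). x N = P i (restrict x {..<N})} \<longleftrightarrow>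
      z (N + i) = P i (restrict z {..<N})" for z
    unfolding mem_Collect_eq r by auto
  ultimately show "{z \<in> Rn (N + k). z (N + i) = P i (restrict z {..<N})} \<in> \<S> (N + k)"
    by (simp only:)
qed

lemma definable_fun_coordinate: "i < n \<Longrightarrow> definable_fun n (\<lambda>x. x i)"
  using definable_diagonal[of n "Suc n" i] by (simp add: definable_fun_def)

lemma definable_fun_restrict:
  assumes "definable_fun n P" shows "definable_fun (Suc n) (\<lambda>x. P (restrict x {..<n}))"
proof -
  let ?\<tau> = "\<lambda>j. if j < n then j else Suc n"
  have r: "restrict (\<lambda>j\<in>{..<Suc n}. z (?\<tau> j)) {..<n} = restrict z {..<n}" for z :: "nat \<Rightarrow> real"
    by (rule ext) simp
  have r': "restrict (restrict z {..<Suc n}) {..<n} = restrict z {..<n}" for z :: "nat \<Rightarrow> real"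
    by (rule ext) simp
  have "{z \<in> Rn (Suc (Suc n)). (\<lambda>j\<in>{..<Suc n}. z (?\<tau> j)) \<in>
      {x \<in> Rn (Suc n). x n = P (restrict x {..<n})}} \<in> \<S> (Suc (Suc n))"
    by (rule definable_substitution) (use assms in \<open>auto simp: definable_fun_def\<close>)
  moreover have "(\<lambda>j\<in>{..<Suc n}. z (?\<tau> j)) \<in> {x \<in> Rn (Suc n). x n = P (restrict x {..<n})} \<longleftrightarrow>
      z (Suc n) = P (restrict (restrict z {..<Suc n}) {..<n})" for z
    unfolding mem_Collect_eq r r' by auto
  ultimately show ?thesis unfolding definable_fun_def by (simp only:)
qed

lemma definable_fun_compose2:
  assumes F: "{x \<in> Rn 3. x 2 = F (x 0) (x 1)} \<in> \<S> 3"
    and P: "definable_fun n P" and Q: "definable_fun n Q"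
  shows "definable_fun n (\<lambda>x. F (P x) (Q x))"
proof -
  let ?G = "\<lambda>i::nat. if i = 0 then (\<lambda>x. P (restrict x {..<n}))
    else if i = 1 then (\<lambda>x. Q (restrict x {..<n})) else (\<lambda>x. x n)"
  have "{x \<in> Rn (Suc n). (\<lambda>i\<in>{..<3}. ?G i x) \<in> {x \<in> Rn 3. x 2 = F (x 0) (x 1)}} \<in> \<S> (Suc n)"
    by (rule definable_preimage[OF F])
      (auto intro: definable_fun_restrict[OF P] definable_fun_restrict[OF Q] definable_fun_coordinate)
  then show ?thesis unfolding definable_fun_def by simp
qed

lemma definable_eq:
  assumes "definable_fun n P" and "definable_fun n Q"
  shows "{x \<in> Rn n. P x = Q x} \<in> \<S> n"
proof -
  have "{x \<in> Rn n. (\<lambda>i\<in>{..<2}. (if i = 0 then P else Q) x) \<in> {x \<in> Rn 2. x 0 = x (2 - 1)}} \<in> \<S> n"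
    by (rule definable_preimage[OF diagonal]) (auto simp: assms)
  then show ?thesis by simp
qed

end

context o_minimal_structure
begin

lemma definable_fun_const: "definable_fun n (\<lambda>x. c)"
proof -
  have "{x \<in> Rn 1. x 0 = c} \<in> \<S> 1"
  proof (subst o_minimal)
    have "c \<in> (\<lambda>x. x 0) ` {x \<in> Rn 1. x 0 = c}"
      by (rule image_eqI[of _ _ "\<lambda>i\<in>{..<1}. c"]) auto
    then have "(\<lambda>x. x 0) ` {x \<in> Rn 1. x 0 = c} = {c}" by auto
    then show "\<exists>\<I>. finite \<I> \<and> (\<forall>I\<in>\<I>. is_interval I) \<and> (\<lambda>x. x 0) ` {x \<in> Rn 1. x 0 = c} = \<Union>\<I>"
      by (intro exI[of _ "{{c}}"]) (auto simp: is_interval_1)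
  qed auto
  from definable_substitution[OF this, of "\<lambda>_. n" "Suc n"]
  show ?thesis by (simp add: definable_fun_def)
qed

lemmas definable_fun_add = definable_fun_compose2[OF plus]
lemmas definable_fun_mult = definable_fun_compose2[OF times]

lemma definable_fun_sum:
  assumes "finite I" and "\<And>i. i \<in> I \<Longrightarrow> definable_fun n (P i)"
  shows "definable_fun n (\<lambda>x. \<Sum>i\<in>I. P i x)"
  using assms by (induction I) (auto intro: definable_fun_const definable_fun_add)

lemma definable_fun_diff:
  assumes "definable_fun n P" and "definable_fun n Q"
  shows "definable_fun n (\<lambda>x. P x - Q x)"
proof -
  have "definable_fun n (\<lambda>x. P x + (-1) * Q x)"
    by (intro definable_fun_add definable_fun_mult definable_fun_const assms)
  then show ?thesis by simp
qed

end

section \<open>Functions with continuous partial derivatives\<close>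

lemma Rn_undefined: "y \<in> Rn n \<Longrightarrow> \<not> i < n \<Longrightarrow> y i = undefined"
  using PiE_arb[of y "{..<n}" "\<lambda>_. UNIV" i] by simp

lemma restrict_Rn_upd:
  assumes "y \<in> Rn n" shows "restrict (y(n := t)) {..<n} = y"
proof
  fix i show "restrict (y(n := t)) {..<n} i = y i"
    using Rn_undefined[OF assms, of i] by (cases "i < n") auto
qed

lemma Rn_upd: "y \<in> Rn n \<Longrightarrow> y(n := t) \<in> Rn (Suc n)"
  by (auto simp: PiE_def extensional_def)

lemma Rn_Suc_eq_upd:
  assumes "x \<in> Rn (Suc n)" shows "(restrict x {..<n})(n := x n) = x"
proof
  fix i show "((restrict x {..<n})(n := x n)) i = x i"
    using Rn_undefined[OF assms, of i] by (cases "i < n"; cases "i = n") auto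
qed

lemma restrict_image_Rn:
  assumes "C \<subseteq> Rn n" shows "(\<lambda>x. restrict x {..<n}) ` C = C"
  using assms by force

lemma restrict_image_restrict:
  "(n::nat) \<le> N \<Longrightarrow> (\<lambda>x. restrict x {..<n}) ` (\<lambda>x. restrict x {..<N}) ` A = (\<lambda>x. restrict x {..<n}) ` A"
  by (simp add: image_image Int_absorb1)

lemma continuous_on_into_Rn:
  assumes "\<And>t. t \<in> T \<Longrightarrow> \<gamma> t \<in> Rn n" and "\<And>i. i < n \<Longrightarrow> continuous_on T (\<lambda>t. \<gamma> t i)"
  shows "continuous_on T \<gamma>"
proof (rule continuous_on_coordinatewise_then_product)
  fix i show "continuous_on T (\<lambda>t. \<gamma> t i)"
  proof (cases "i < n")
    case False
    have "\<gamma> t i = undefined" if "t \<in> T" for t by (rule Rn_undefined[OF assms(1)[OF that] False])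
    then show ?thesis by (subst continuous_on_cong[OF refl]) auto
  qed (rule assms(2))
qed

text \<open>
  The chain rule for a function with continuous partial derivatives along a curve.  The variables of
  \<open>F\<close> are moved from \<open>\<gamma> a\<close> to \<open>\<gamma> t\<close> one at a time, and each move adds one summand by the
  two-variable criterion \<open>has_derivative_partialsI\<close>.
\<close>

lemma Ck_Rn_1_chain_rule:
  assumes U: "openin (top_of_set (Rn n)) U" and F: "Ck_Rn n 1 U F"
    and T: "open T" "a \<in> T" and \<gamma>U: "\<And>t. t \<in> T \<Longrightarrow> \<gamma> t \<in> U"
    and der: "\<And>i t. i < n \<Longrightarrow> t \<in> T \<Longrightarrow> ((\<lambda>t. \<gamma> t i) has_real_derivative \<gamma>' i t) (at t)"
  shows "((\<lambda>t. F (\<gamma> t)) has_real_derivative (\<Sum>i<n. partial i F (\<gamma> a) * \<gamma>' i a)) (at a)"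
proof -
  have UR: "U \<subseteq> Rn n" using openin_imp_subset[OF U] .
  obtain T' where T': "open T'" "U = Rn n \<inter> T'" using U by (auto simp: openin_open)
  have \<gamma>R: "\<gamma> t \<in> Rn n" if "t \<in> T" for t using \<gamma>U[OF that] UR by blast
  have \<gamma>cont: "continuous_on T (\<lambda>t. \<gamma> t i)" if "i < n" for i
    using DERIV_isCont[OF der[OF that]] by (simp add: continuous_at_imp_continuous_on)
  \<comment> \<open>Only the first \<open>k\<close> variables follow the curve.\<close>
  define z where "z k t = (\<lambda>i. if i < k then \<gamma> t i else \<gamma> a i)" for k t
  have zR: "z k t \<in> Rn n" if "k \<le> n" "t \<in> T" for k t
    using \<gamma>R[OF T(2)] \<gamma>R[OF that(2)] by (auto simp: z_def PiE_def extensional_def)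
  have za: "z k a = \<gamma> a" for k by (auto simp: z_def)
  have "((\<lambda>t. F (z k t)) has_real_derivative (\<Sum>i<k. partial i F (\<gamma> a) * \<gamma>' i a)) (at a)"
    if "k \<le> n" for k
    using that
  proof (induction k)
    case 0
    show ?case by (simp add: z_def)
  next
    case (Suc k)
    then have k: "k < n" "k \<le> n" by auto
    define w where "w p = (z k (fst p))(k := snd p)" for p
    have wR: "w p \<in> Rn n" if "p \<in> T \<times> UNIV" for p
      using zR[OF k(2), of "fst p"] that k(1) by (auto simp: w_def PiE_def extensional_def)
    have wcont: "continuous_on (T \<times> UNIV) w"
    proof (rule continuous_on_into_Rn[OF wR])
      fix i assume "i < n"
      then have "continuous_on (T \<times> (UNIV::real set)) (\<lambda>p. \<gamma> (fst p) i)"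
        by (intro continuous_on_compose2[OF \<gamma>cont] continuous_intros) auto
      then show "continuous_on (T \<times> UNIV) (\<lambda>p. w p i)"
        by (cases "i = k"; cases "i < k") (auto simp: w_def z_def intro!: continuous_intros)
    qed
    have "open ((T \<times> UNIV) \<inter> w -` T')"
      by (intro continuous_open_preimage wcont open_Times T T' open_UNIV)
    moreover have wa: "w (a, \<gamma> a k) = \<gamma> a" by (auto simp: w_def za)
    then have "(a, \<gamma> a k) \<in> (T \<times> UNIV) \<inter> w -` T'" using T \<gamma>U[OF T(2)] T' by auto
    ultimately obtain A B where AB: "open A" "open B" "(a, \<gamma> a k) \<in> A \<times> B"
        "A \<times> B \<subseteq> (T \<times> UNIV) \<inter> w -` T'"
      by (rule open_prod_elim)
    obtain e where e: "e > 0" "ball (\<gamma> a k) e \<subseteq> B" using AB openE by blast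
    let ?Y = "ball (\<gamma> a k) e"
    have wU: "w p \<in> U" if "p \<in> A \<times> ?Y" for p
    proof -
      have "p \<in> A \<times> B" using that e(2) by auto
      then have "p \<in> (T \<times> UNIV) \<inter> w -` T'" using AB(4) by blast
      then show ?thesis using wR[of p] T'(2) by simp
    qed
    have AT: "A \<subseteq> T" using AB by auto
    have pc: "continuous_on U (partial k F)" and
      pd: "\<And>x. x \<in> U \<Longrightarrow> (\<lambda>t. F (x(k := t))) differentiable (at (x k))"
      using F k by auto
    have "((\<lambda>(t, \<tau>). F (w (t, \<tau>))) has_derivative
        (\<lambda>(tx, ty). (\<lambda>h. (\<Sum>i<k. partial i F (\<gamma> a) * \<gamma>' i a) * h) tx +
          blinfun_mult_right (partial k F (w (a, \<gamma> a k))) ty)) (at (a, \<gamma> a k) within A \<times> ?Y)"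
    proof (rule has_derivative_partialsI[where fy = "\<lambda>t \<tau>. blinfun_mult_right (partial k F (w (t, \<tau>)))"])
      have "w (t, \<gamma> a k) = z k t" for t by (auto simp: w_def z_def)
      then show "((\<lambda>t. F (w (t, \<gamma> a k))) has_derivative
          (\<lambda>h. (\<Sum>i<k. partial i F (\<gamma> a) * \<gamma>' i a) * h)) (at a within A)"
        using has_field_derivative_at_within[OF Suc.IH[OF k(2)]] by (simp add: has_field_derivative_def)
    next
      fix t \<tau> assume "t \<in> A" "\<tau> \<in> ?Y"
      then have u: "w (t, \<tau>) \<in> U" using wU by blast
      have eq: "(w (t, \<tau>))(k := s) = w (t, s)" "w (t, \<tau>) k = \<tau>" for s by (auto simp: w_def)
      have "((\<lambda>s. F (w (t, s))) has_real_derivative partial k F (w (t, \<tau>))) (at \<tau>)"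
        using pd[OF u] unfolding partial_def eq by (simp add: DERIV_deriv_iff_real_differentiable)
      then have "((\<lambda>s. F (w (t, s))) has_derivative (\<lambda>h. partial k F (w (t, \<tau>)) * h)) (at \<tau> within ?Y)"
        using has_field_derivative_at_within has_field_derivative_def by blast
      then show "((\<lambda>s. F (w (t, s))) has_derivative
          blinfun_apply (blinfun_mult_right (partial k F (w (t, \<tau>))))) (at \<tau> within ?Y)"
        by simp
    next
      have "continuous_on (A \<times> ?Y) (\<lambda>p. blinfun_mult_right (partial k F (w p)))"
      proof (rule bounded_linear.continuous_on[OF bounded_linear_blinfun_mult_right])
        show "continuous_on (A \<times> ?Y) (\<lambda>p. partial k F (w p))"
          by (rule continuous_on_compose2[OF pc continuous_on_subset[OF wcont]])
            (use wU AT in auto)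
      qed
      then show "continuous (at (a, \<gamma> a k) within A \<times> ?Y)
          (\<lambda>(t, \<tau>). blinfun_mult_right (partial k F (w (t, \<tau>))))"
        using AB(3) e(1) by (simp add: continuous_on_eq_continuous_within case_prod_unfold)
    qed (use e in auto)
    moreover have "at (a, \<gamma> a k) within A \<times> ?Y = at (a, \<gamma> a k)"
      by (rule at_within_open) (use AB e in \<open>auto intro: open_Times\<close>)
    ultimately have G: "((\<lambda>p. F (w p)) has_derivative
        (\<lambda>p. (\<Sum>i<k. partial i F (\<gamma> a) * \<gamma>' i a) * fst p + partial k F (\<gamma> a) * snd p)) (at (a, \<gamma> a k))"
      by (simp add: case_prod_unfold wa)
    have "((\<lambda>t. (t, \<gamma> t k)) has_derivative (\<lambda>h. (h, \<gamma>' k a * h))) (at a)"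
      using der[OF k(1) T(2)] by (auto intro!: derivative_eq_intros simp: has_field_derivative_def)
    from diff_chain_at[OF this G]
    have "((\<lambda>t. F (w (t, \<gamma> t k))) has_derivative
        (\<lambda>h. (\<Sum>i<k. partial i F (\<gamma> a) * \<gamma>' i a) * h + partial k F (\<gamma> a) * (\<gamma>' k a * h))) (at a)"
      by (simp add: o_def)
    moreover have "w (t, \<gamma> t k) = z (Suc k) t" for t by (auto simp: w_def z_def less_Suc_eq)
    moreover have "(\<lambda>h. (\<Sum>i<k. partial i F (\<gamma> a) * \<gamma>' i a) * h + partial k F (\<gamma> a) * (\<gamma>' k a * h)) =
        (*) (\<Sum>i<Suc k. partial i F (\<gamma> a) * \<gamma>' i a)"
      by (rule ext) (simp add: algebra_simps)
    ultimately show ?case by (simp only: has_field_derivative_def)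
  qed
  from this[of n] have "((\<lambda>t. F (z n t)) has_real_derivative (\<Sum>i<n. partial i F (\<gamma> a) * \<gamma>' i a)) (at a)"
    by simp
  moreover have "F (z n t) = F (\<gamma> t)" if "t \<in> T" for t
  proof -
    have "z n t = \<gamma> t"
    proof
      fix i show "z n t i = \<gamma> t i"
        using Rn_undefined[OF \<gamma>R[OF that], of i] Rn_undefined[OF \<gamma>R[OF T(2)], of i]
        by (cases "i < n") (auto simp: z_def)
    qed
    then show ?thesis by simp
  qed
  ultimately show ?thesis
    using DERIV_cong_ev T by (smt (verit) has_field_derivative_transform_within_open)
qed

section \<open>Lifting lines to cells\<close>

lemma smooth_Rn_continuous_on:
  assumes "smooth_Rn \<S> n A f" shows "continuous_on A f"
proof -
  obtain U F where "A \<subseteq> U" "\<forall>k. Ck_Rn n k U F" "\<forall>x\<in>A. F x = f x"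
    using assms unfolding smooth_Rn_def by blast
  moreover then have "continuous_on U F" by (metis Ck_Rn.simps(1))
  ultimately show ?thesis
    using continuous_on_subset continuous_on_cong by metis
qed

lemma cell_bound_continuous_on:
  assumes "cell_bound \<S> n C f" shows "continuous_on C f"
  using assms unfolding cell_bound_def by (auto intro!: smooth_Rn_continuous_on continuous_on_ereal)

lemma smooth_cell_subset: "smooth_cell \<S> n C \<Longrightarrow> C \<subseteq> Rn n"
  by (induction rule: smooth_cell.induct) (auto simp: graph_Rn_def)

lemma graph_Rn_projection:
  assumes "C \<subseteq> Rn n" shows "(\<lambda>x. restrict x {..<n}) ` graph_Rn n C f = C"
proof (intro equalityI subsetI)
  fix y assume y: "y \<in> C"
  then have "y \<in> Rn n" using assms by blast
  then have "restrict (y(n := f y)) {..<n} = y" "y(n := f y) \<in> Rn (Suc n)"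
    by (rule restrict_Rn_upd, rule Rn_upd)
  then show "y \<in> (\<lambda>x. restrict x {..<n}) ` graph_Rn n C f"
    using y by (intro image_eqI[of y _ "y(n := f y)"]) (auto simp: graph_Rn_def)
qed (auto simp: graph_Rn_def)

abbreviation band_Rn where
  "band_Rn n C f g \<equiv> {x \<in> Rn (Suc n). restrict x {..<n} \<in> C \<and>
      f (restrict x {..<n}) < ereal (x n) \<and> ereal (x n) < g (restrict x {..<n})}"

lemma band_Rn_projection:
  assumes "C \<subseteq> Rn n" and "\<forall>x\<in>C. f x < g x"
  shows "(\<lambda>x. restrict x {..<n}) ` band_Rn n C f g = C"
proof (intro equalityI subsetI)
  fix y assume y: "y \<in> C"
  then obtain t where t: "f y < ereal t" "ereal t < g y" using assms(2) ereal_dense2 by blast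
  have "y \<in> Rn n" using y assms by blast
  then have "restrict (y(n := t)) {..<n} = y" "y(n := t) \<in> Rn (Suc n)"
    by (rule restrict_Rn_upd, rule Rn_upd)
  then show "y \<in> (\<lambda>x. restrict x {..<n}) ` band_Rn n C f g"
    using y t by (intro image_eqI[of y _ "y(n := t)"]) auto
qed auto

text \<open>
  The points of \<open>Rn N\<close> are functions without a norm, so continuous differentiability of the curve \<open>\<gamma>\<close>
  is expressed coordinate by coordinate.
\<close>

definition lifts_line where
  "lifts_line n N C c v \<longleftrightarrow> (\<exists>\<epsilon>>0. \<exists>\<gamma> \<gamma>'. \<gamma> 0 = c \<and>
     (\<forall>t\<in>{-\<epsilon><..<\<epsilon>::real}. \<gamma> t \<in> C \<and> (\<forall>i<n. \<gamma> t i = c i + t * v i) \<and>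
       (\<forall>i<N. ((\<lambda>t. \<gamma> t i) has_real_derivative \<gamma>' i t) (at t))) \<and>
     (\<forall>i<N. continuous_on {-\<epsilon><..<\<epsilon>} (\<gamma>' i)))"

lemma lifts_line_open:
  assumes C: "openin (top_of_set (Rn n)) C" and c: "c \<in> C"
  shows "lifts_line n n C c v"
proof -
  obtain T where T: "open T" "C = Rn n \<inter> T" using C by (auto simp: openin_open)
  define \<gamma> where "\<gamma> t = (\<lambda>i\<in>{..<n}. c i + t * v i)" for t
  have \<gamma>R: "\<gamma> t \<in> Rn n" for t by (auto simp: \<gamma>_def)
  have "continuous_on UNIV \<gamma>"
    by (rule continuous_on_into_Rn[OF \<gamma>R]) (auto simp: \<gamma>_def intro!: continuous_intros)
  then have "open (\<gamma> -` T)" using T by (auto intro: open_vimage)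
  moreover have \<gamma>0: "\<gamma> 0 = c"
  proof
    have "c \<in> Rn n" using c T by blast
    then show "\<gamma> 0 i = c i" for i
      using Rn_undefined[of c n i] by (cases "i < n") (auto simp: \<gamma>_def)
  qed
  then have "0 \<in> \<gamma> -` T" using c T by simp
  ultimately obtain \<epsilon> where e: "0 < \<epsilon>" "ball (0::real) \<epsilon> \<subseteq> \<gamma> -` T" using openE by blast
  have "\<gamma> t \<in> C" if "t \<in> {-\<epsilon><..<\<epsilon>}" for t
  proof -
    have "t \<in> ball 0 \<epsilon>" using that by (simp add: ball_eq_greaterThanLessThan)
    then show ?thesis using e(2) \<gamma>R T(2) by blast
  qed
  moreover have "((\<lambda>t. \<gamma> t i) has_real_derivative v i) (at t)" if "i < n" for i t
    using that by (auto simp: \<gamma>_def intro!: derivative_eq_intros)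
  moreover have "\<gamma> t i = c i + t * v i" if "i < n" for i t using that by (simp add: \<gamma>_def)
  ultimately show ?thesis
    unfolding lifts_line_def using e(1) \<gamma>0
    by (intro exI[of _ \<epsilon>] conjI exI[of _ \<gamma>] exI[of _ "\<lambda>i t. v i"]) auto
qed

text \<open>
  Over a graph the new coordinate is the value of the function along the curve below.
\<close>

lemma lifts_line_graph:
  assumes l: "lifts_line n N C (restrict c {..<N}) v" and n: "n \<le> N" and f: "smooth_Rn \<S> N C f"
    and C: "C \<subseteq> Rn N" and c: "c \<in> graph_Rn N C f"
  shows "lifts_line n (Suc N) (graph_Rn N C f) c v"
proof -
  obtain \<epsilon> \<gamma> \<gamma>' where e: "0 < \<epsilon>" and \<gamma>0: "\<gamma> 0 = restrict c {..<N}"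
    and \<gamma>: "\<And>t. t \<in> {-\<epsilon><..<\<epsilon>} \<Longrightarrow> \<gamma> t \<in> C"
      "\<And>t i. t \<in> {-\<epsilon><..<\<epsilon>} \<Longrightarrow> i < n \<Longrightarrow> \<gamma> t i = restrict c {..<N} i + t * v i"
      "\<And>t i. t \<in> {-\<epsilon><..<\<epsilon>} \<Longrightarrow> i < N \<Longrightarrow> ((\<lambda>t. \<gamma> t i) has_real_derivative \<gamma>' i t) (at t)"
    and \<gamma>': "\<And>i. i < N \<Longrightarrow> continuous_on {-\<epsilon><..<\<epsilon>} (\<gamma>' i)"
    using l unfolding lifts_line_def by blast
  let ?I = "{-\<epsilon><..<\<epsilon>}"
  obtain U F where U: "openin (top_of_set (Rn N)) U" "C \<subseteq> U" and F: "\<And>k. Ck_Rn N k U F"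
      "\<And>x. x \<in> C \<Longrightarrow> F x = f x"
    using f unfolding smooth_Rn_def by blast
  have F1: "Ck_Rn N 1 U F" by (rule F)
  define \<delta> where "\<delta> t = (\<gamma> t)(N := F (\<gamma> t))" for t
  define \<delta>' where "\<delta>' i = (if i < N then \<gamma>' i else (\<lambda>t. \<Sum>j<N. partial j F (\<gamma> t) * \<gamma>' j t))" for i
  have \<gamma>cont: "continuous_on ?I \<gamma>"
    by (rule continuous_on_into_Rn[of _ _ N])
      (use \<gamma>(1) C DERIV_isCont[OF \<gamma>(3)] in \<open>auto simp: continuous_at_imp_continuous_on\<close>)
  have "F (restrict c {..<N}) = c N" using c F(2) by (simp add: graph_Rn_def)
  then have "\<delta> 0 = (restrict c {..<N})(N := c N)" by (simp only: \<delta>_def \<gamma>0)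
  then have "\<delta> 0 = c" using Rn_Suc_eq_upd[of c N] c by (simp add: graph_Rn_def)
  moreover have "\<delta> t \<in> graph_Rn N C f" if "t \<in> ?I" for t
  proof -
    have R: "\<gamma> t \<in> Rn N" using \<gamma>(1)[OF that] C by blast
    show ?thesis
      using \<gamma>(1)[OF that] F(2) Rn_upd[OF R] restrict_Rn_upd[OF R] by (auto simp: graph_Rn_def \<delta>_def)
  qed
  moreover have "\<delta> t i = c i + t * v i" if "t \<in> ?I" "i < n" for t i
    using \<gamma>(2)[OF that] that n by (simp add: \<delta>_def)
  moreover have "((\<lambda>t. \<delta> t i) has_real_derivative \<delta>' i t) (at t)" if "t \<in> ?I" "i < Suc N" for t i
  proof (cases "i < N")
    case True
    then show ?thesis using \<gamma>(3)[OF that(1) True] by (simp add: \<delta>_def \<delta>'_def)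
  next
    case False
    have "((\<lambda>t. F (\<gamma> t)) has_real_derivative (\<Sum>j<N. partial j F (\<gamma> t) * \<gamma>' j t)) (at t)"
      by (rule Ck_Rn_1_chain_rule[OF U(1) F1 _ that(1)]) (use \<gamma> U in auto)
    then show ?thesis using False that by (simp add: \<delta>_def \<delta>'_def)
  qed
  moreover have "continuous_on ?I (\<delta>' i)" if "i < Suc N" for i
  proof (cases "i < N")
    case False
    have "continuous_on ?I (\<lambda>t. partial j F (\<gamma> t))" if "j < N" for j
      by (rule continuous_on_compose2[OF _ \<gamma>cont, of U]) (use F1 that \<gamma>(1) U in auto)
    then show ?thesis using False \<gamma>' by (auto simp: \<delta>'_def intro!: continuous_intros)
  qed (simp add: \<delta>'_def \<gamma>')
  ultimately show ?thesis
    unfolding lifts_line_def using e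
    by (intro exI[of _ \<epsilon>] conjI exI[of _ \<delta>] exI[of _ \<delta>']) blast+
qed

text \<open>
  Over a band the new coordinate can be kept constant: both bounds are continuous, so for a short time
  the curve stays strictly between them.
\<close>

lemma lifts_line_band:
  assumes l: "lifts_line n N C (restrict c {..<N}) v" and n: "n \<le> N"
    and f: "continuous_on C f" and g: "continuous_on C g"
    and C: "C \<subseteq> Rn N" and c: "c \<in> band_Rn N C f g"
  shows "lifts_line n (Suc N) (band_Rn N C f g) c v"
proof -
  obtain \<epsilon> \<gamma> \<gamma>' where e: "0 < \<epsilon>" and \<gamma>0: "\<gamma> 0 = restrict c {..<N}"
    and \<gamma>: "\<And>t. t \<in> {-\<epsilon><..<\<epsilon>} \<Longrightarrow> \<gamma> t \<in> C"
      "\<And>t i. t \<in> {-\<epsilon><..<\<epsilon>} \<Longrightarrow> i < n \<Longrightarrow> \<gamma> t i = restrict c {..<N} i + t * v i"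
      "\<And>t i. t \<in> {-\<epsilon><..<\<epsilon>} \<Longrightarrow> i < N \<Longrightarrow> ((\<lambda>t. \<gamma> t i) has_real_derivative \<gamma>' i t) (at t)"
    and \<gamma>': "\<And>i. i < N \<Longrightarrow> continuous_on {-\<epsilon><..<\<epsilon>} (\<gamma>' i)"
    using l unfolding lifts_line_def by blast
  let ?I = "{-\<epsilon><..<\<epsilon>}"
  have \<gamma>cont: "continuous_on ?I \<gamma>"
    by (rule continuous_on_into_Rn[of _ _ N])
      (use \<gamma>(1) C DERIV_isCont[OF \<gamma>(3)] in \<open>auto simp: continuous_at_imp_continuous_on\<close>)
  have fc: "continuous_on ?I (\<lambda>t. f (\<gamma> t))" and gc: "continuous_on ?I (\<lambda>t. g (\<gamma> t))"
    by (rule continuous_on_compose2[OF f \<gamma>cont] continuous_on_compose2[OF g \<gamma>cont];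
        use \<gamma>(1) in blast)+
  have "open (?I \<inter> (\<lambda>t. f (\<gamma> t)) -` {..<ereal (c N)} \<inter> (?I \<inter> (\<lambda>t. g (\<gamma> t)) -` {ereal (c N)<..}))"
    by (intro open_Int continuous_open_preimage fc gc) auto
  moreover have "0 \<in> ?I \<inter> (\<lambda>t. f (\<gamma> t)) -` {..<ereal (c N)} \<inter> (?I \<inter> (\<lambda>t. g (\<gamma> t)) -` {ereal (c N)<..})"
    using e c by (auto simp: \<gamma>0)
  ultimately obtain \<eta> where h: "0 < \<eta>"
      "ball 0 \<eta> \<subseteq> ?I \<inter> (\<lambda>t. f (\<gamma> t)) -` {..<ereal (c N)} \<inter> (?I \<inter> (\<lambda>t. g (\<gamma> t)) -` {ereal (c N)<..})"
    using openE by blast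
  let ?J = "{-\<eta><..<\<eta>}"
  have J: "t \<in> ?I" "f (\<gamma> t) < ereal (c N)" "ereal (c N) < g (\<gamma> t)" if "t \<in> ?J" for t
    using h(2) that by (auto simp: ball_eq_greaterThanLessThan)
  define \<delta> where "\<delta> t = (\<gamma> t)(N := c N)" for t
  define \<delta>' where "\<delta>' i = (if i < N then \<gamma>' i else (\<lambda>t. 0))" for i
  have "\<delta> 0 = c"
    using Rn_Suc_eq_upd[of c N] c by (auto simp: \<delta>_def \<gamma>0)
  moreover have "\<delta> t \<in> band_Rn N C f g" if "t \<in> ?J" for t
  proof -
    have R: "\<gamma> t \<in> Rn N" using \<gamma>(1)[OF J(1)[OF that]] C by blast
    show ?thesis
      using \<gamma>(1) J[OF that] Rn_upd[OF R] restrict_Rn_upd[OF R] by (auto simp: \<delta>_def)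
  qed
  moreover have "\<delta> t i = c i + t * v i" if "t \<in> ?J" "i < n" for t i
    using \<gamma>(2)[OF J(1)[OF that(1)] that(2)] that n by (simp add: \<delta>_def)
  moreover have "((\<lambda>t. \<delta> t i) has_real_derivative \<delta>' i t) (at t)" if "t \<in> ?J" "i < Suc N" for t i
    using \<gamma>(3)[OF J(1)[OF that(1)]] that by (auto simp: \<delta>_def \<delta>'_def)
  moreover have "continuous_on ?J (\<delta>' i)" if "i < Suc N" for i
  proof -
    have "?J \<subseteq> ?I" using J(1) by blast
    then show ?thesis using continuous_on_subset[OF \<gamma>', of i ?J] by (auto simp: \<delta>'_def)
  qed
  ultimately show ?thesis
    unfolding lifts_line_def using h(1)
    by (intro exI[of _ \<eta>] conjI exI[of _ \<delta>] exI[of _ \<delta>']) blast+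
qed

text \<open>
  A cell whose projection is open lies over that projection like a submersion: every line in the base
  lifts through every point of the cell.  This takes over the part of Sard's theorem, since above a point
  of an open cell there are no critical points at all.
\<close>

lemma smooth_cell_lifts_line:
  assumes "smooth_cell \<S> N C" and "n \<le> N" and "c \<in> C"
    and "openin (top_of_set (Rn n)) ((\<lambda>x. restrict x {..<n}) ` C)"
  shows "lifts_line n N C c v"
  using assms
proof (induction arbitrary: c rule: smooth_cell.induct)
  case point
  then have n: "n = 0" by simp
  show ?case unfolding n by (rule lifts_line_open) (use point in auto)
next
  case (graph N C f)
  have C: "C \<subseteq> Rn N" using graph smooth_cell_subset by blast
  show ?case
  proof (cases "n = Suc N")
    case True
    have "graph_Rn N C f \<subseteq> Rn n" by (auto simp: graph_Rn_def True)
    from graph(6)[unfolded restrict_image_Rn[OF this]] show ?thesis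
      unfolding True by (rule lifts_line_open) (rule graph.prems)
  next
    case False
    then have n: "n \<le> N" using graph.prems by simp
    have eq: "(\<lambda>x. restrict x {..<n}) ` graph_Rn N C f = (\<lambda>x. restrict x {..<n}) ` C"
      using restrict_image_restrict[OF n, of "graph_Rn N C f"] unfolding graph_Rn_projection[OF C] by (rule sym)
    have "restrict c {..<N} \<in> C" using graph.prems unfolding graph_Rn_def by blast
    then have "lifts_line n N C (restrict c {..<N}) v"
      using graph.prems(3) unfolding eq by (rule graph.IH[OF n])
    then show ?thesis using lifts_line_graph n graph C by blast
  qed
next
  case (band N C f g)
  have C: "C \<subseteq> Rn N" using band smooth_cell_subset by blast
  show ?case
  proof (cases "n = Suc N")
    case True
    have "band_Rn N C f g \<subseteq> Rn n" by (auto simp: True)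
    from band(8)[unfolded restrict_image_Rn[OF this]] show ?thesis
      unfolding True by (rule lifts_line_open) (rule band.prems)
  next
    case False
    then have n: "n \<le> N" using band.prems by simp
    have eq: "(\<lambda>x. restrict x {..<n}) ` band_Rn N C f g = (\<lambda>x. restrict x {..<n}) ` C"
      using restrict_image_restrict[OF n, of "band_Rn N C f g"] unfolding band_Rn_projection[OF C band(4)] by (rule sym)
    have "restrict c {..<N} \<in> C" using band.prems by blast
    then have "lifts_line n N C (restrict c {..<N}) v"
      using band.prems(3) unfolding eq by (rule band.IH[OF n])
    then show ?thesis
      by (rule lifts_line_band[OF _ n _ _ C]) (use band cell_bound_continuous_on in blast)+
  qed
qed

section \<open>Open cells in a decomposition\<close>

lemma smooth_decomposition_partition:
  assumes "smooth_decomposition \<S> n \<D>"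
  shows "finite \<D>" and "partition_on (Rn n) \<D>" and "\<And>C. C \<in> \<D> \<Longrightarrow> smooth_cell \<S> n C"
proof -
  have "finite \<D> \<and> partition_on (Rn n) \<D> \<and> (\<forall>C\<in>\<D>. smooth_cell \<S> n C)"
  proof (cases n)
    case 0
    then have "\<D> = {Rn 0}" using assms by simp
    with 0 show ?thesis using partition_on_space[of "Rn 0"] smooth_cell.point by auto
  qed (use assms in auto)
  then show "finite \<D>" and "partition_on (Rn n) \<D>" and "\<And>C. C \<in> \<D> \<Longrightarrow> smooth_cell \<S> n C" by auto
qed

lemma smooth_decomposition_project:
  assumes "smooth_decomposition \<S> N \<D>" and "n \<le> N"
  shows "smooth_decomposition \<S> n ((`) (\<lambda>x. restrict x {..<n}) ` \<D>)"
  using assms(2,1)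
proof (induction N arbitrary: \<D> rule: dec_induct)
  case base
  have "C \<subseteq> Rn n" if "C \<in> \<D>" for C
    using smooth_cell_subset smooth_decomposition_partition(3)[OF base that] by blast
  then have "(`) (\<lambda>x. restrict x {..<n}) ` \<D> = \<D>" using restrict_image_Rn by force
  with base show ?case by argo
next
  case (step N)
  have "(`) (\<lambda>x. restrict x {..<n}) ` (`) (\<lambda>x. restrict x {..<N}) ` \<D> = (`) (\<lambda>x. restrict x {..<n}) ` \<D>"
    using step(1) by (simp add: image_image Int_absorb1)
  then show ?case using step.IH[of "(`) (\<lambda>x. restrict x {..<N}) ` \<D>"] step.prems
    unfolding smooth_decomposition.simps by argo
qed

lemma partition_on_unique:
  "partition_on A P \<Longrightarrow> B \<in> P \<Longrightarrow> C \<in> P \<Longrightarrow> x \<in> B \<Longrightarrow> x \<in> C \<Longrightarrow> B = C"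
  using partition_onD2 disjointD by blast

lemma openin_band_Rn:
  assumes C: "openin (top_of_set (Rn n)) C" and f: "continuous_on C f" and g: "continuous_on C g"
  shows "openin (top_of_set (Rn (Suc n))) (band_Rn n C f g)"
proof -
  let ?\<pi> = "\<lambda>x::nat \<Rightarrow> real. restrict x {..<n}"
  have \<pi>: "continuous_on A ?\<pi>" for A
    by (rule continuous_on_into_Rn[of _ _ n])
      (auto intro: continuous_on_subset[OF continuous_on_product_coordinates])
  define P where "P = Rn (Suc n) \<inter> ?\<pi> -` C"
  have P: "openin (top_of_set (Rn (Suc n))) P"
    unfolding P_def by (rule continuous_openin_preimage[OF \<pi> _ C]) auto
  have "continuous_on P (\<lambda>x. x n)"
    by (rule continuous_on_subset[OF continuous_on_product_coordinates]) simp
  then have "continuous_on P (\<lambda>x. ereal (x n))" by (rule continuous_on_ereal)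
  moreover have "continuous_on P (\<lambda>x. f (?\<pi> x))" "continuous_on P (\<lambda>x. g (?\<pi> x))"
    by (rule continuous_on_compose2[OF f \<pi>] continuous_on_compose2[OF g \<pi>]; auto simp: P_def)+
  ultimately have "continuous_on P (\<lambda>x. (f (?\<pi> x), ereal (x n)))"
      "continuous_on P (\<lambda>x. (ereal (x n), g (?\<pi> x)))"
    by (auto intro: continuous_on_Pair)
  moreover have "open {p :: ereal \<times> ereal. fst p < snd p}"
    by (intro open_Collect_less continuous_intros)
  ultimately have "openin (top_of_set P)
      ((P \<inter> (\<lambda>x. (f (?\<pi> x), ereal (x n))) -` {p. fst p < snd p}) \<inter>
       (P \<inter> (\<lambda>x. (ereal (x n), g (?\<pi> x))) -` {p. fst p < snd p}))"
    by (intro openin_Int continuous_openin_preimage_gen)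
  also have "(P \<inter> (\<lambda>x. (f (?\<pi> x), ereal (x n))) -` {p. fst p < snd p}) \<inter>
       (P \<inter> (\<lambda>x. (ereal (x n), g (?\<pi> x))) -` {p. fst p < snd p}) = band_Rn n C f g"
    by (auto simp: P_def)
  finally show ?thesis using P openin_trans by blast
qed

text \<open>
  The open cell \<open>B\<close> exists in the projected decomposition by induction.  A vertical line over a point of
  \<open>B\<close> is infinite but meets only finitely many cells, so it meets some cell in more than one point;
  that cell is not a graph but a band, and a band over an open cell is open.
\<close>

lemma smooth_decomposition_open_cell:
  assumes "smooth_decomposition \<S> n \<D>"
  shows "\<exists>C\<in>\<D>. openin (top_of_set (Rn n)) C"
  using assms
proof (induction n arbitrary: \<D>)
  case 0
  then show ?case by simp
next
  case (Suc n)
  let ?\<pi> = "\<lambda>x::nat \<Rightarrow> real. restrict x {..<n}"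
  have D': "smooth_decomposition \<S> n ((`) ?\<pi> ` \<D>)" using Suc.prems by simp
  then obtain B where B: "B \<in> (`) ?\<pi> ` \<D>" "openin (top_of_set (Rn n)) B" using Suc.IH by blast
  note part = smooth_decomposition_partition[OF Suc.prems]
  note part' = smooth_decomposition_partition[OF D']
  obtain b where b: "b \<in> B" using partition_onD3[OF part'(2)] B(1) by (metis ex_in_conv)
  have bR: "b \<in> Rn n" using b B(2) openin_imp_subset by blast
  have "\<exists>C\<in>\<D>. b(n := t) \<in> C" for t
    using partition_onD1[OF part(2)] Rn_upd[OF bR, of t] by blast
  then obtain C where C: "\<And>t. C t \<in> \<D>" "\<And>t. b(n := t) \<in> C t" by metis
  have "finite (range C)" using C(1) part(1) by (meson finite_subset image_subsetI)
  then obtain t where t: "infinite {s. C s = C t}"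
    using pigeonhole_infinite[of "UNIV :: real set" C] infinite_UNIV_char_0 by auto
  have CB: "?\<pi> ` C t = B"
  proof (rule partition_on_unique[OF part'(2) _ B(1)])
    show "b \<in> ?\<pi> ` C t" using C(2)[of t] restrict_Rn_upd[OF bR, of t] by (metis image_eqI)
  qed (use C b in auto)
  from part(3)[OF C(1)[of t]] show ?case
  proof cases
    case (graph C' f)
    have "{s. C s = C t} \<subseteq> {f b}"
    proof
      fix s assume "s \<in> {s. C s = C t}"
      then have "b(n := s) \<in> graph_Rn n C' f" using C(2)[of s] graph by simp
      then show "s \<in> {f b}" using restrict_Rn_upd[OF bR, of s] by (simp add: graph_Rn_def)
    qed
    with t show ?thesis using finite_subset by blast
  next
    case (band C' f g)
    have "C' = B"
      using CB band_Rn_projection[OF smooth_cell_subset[OF band(2)] band(5)] unfolding band(1) by argo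
    then have "openin (top_of_set (Rn (Suc n))) (C t)"
      unfolding band(1) using B(2) band by (intro openin_band_Rn cell_bound_continuous_on) auto
    with C(1) show ?thesis by blast
  qed
qed

section \<open>Vectors and definability of the quadratic family\<close>

definition vec_of :: "(nat \<Rightarrow> 'n) \<Rightarrow> (nat \<Rightarrow> real) \<Rightarrow> real ^ 'n" where
  "vec_of h x = (\<chi> j. x (inv_into {..<CARD('n)} h j))"

definition coords :: "(nat \<Rightarrow> 'n) \<Rightarrow> real ^ 'n \<Rightarrow> nat \<Rightarrow> real" where
  "coords h v = (\<lambda>i\<in>{..<CARD('n)}. v $ h i)"

lemma definable_coords:
  "definable \<S> (A :: (real ^ 'n) set) \<longleftrightarrow>
     (\<exists>h. bij_betw h {..<CARD('n)} (UNIV :: 'n set) \<and> coords h ` A \<in> \<S> CARD('n))"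
  by (simp add: definable_def coords_def[abs_def])

lemma ex_enumeration: "\<exists>h. bij_betw h {..<CARD('n)} (UNIV :: 'n::finite set)"
  using ex_bij_betw_nat_finite[of "UNIV :: 'n set"] by (simp add: atLeast0LessThan)

context
  fixes h :: "nat \<Rightarrow> 'n::finite"
  assumes h: "bij_betw h {..<CARD('n)} UNIV"
begin

lemma inv_enumeration_less: "inv_into {..<CARD('n)} h j < CARD('n)"
  using inv_into_into[of j h "{..<CARD('n)}"] h by (auto simp: bij_betw_def)

lemma vec_of_coords: "vec_of h (coords h v) = v"
  using inv_enumeration_less h
  by (simp add: vec_of_def coords_def vec_eq_iff bij_betw_inv_into_right[OF h])

lemma coords_vec_of: "coords h (vec_of h x) = restrict x {..<CARD('n)}"
  by (rule ext) (simp add: vec_of_def coords_def bij_betw_inv_into_left[OF h])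

lemma coords_mem_image_iff: "coords h v \<in> coords h ` A \<longleftrightarrow> v \<in> A"
  using vec_of_coords by (metis image_iff)

end

context o_minimal_structure
begin

text \<open>
  Definability of a set of vectors provides some enumeration of the coordinates.  Composing with it is
  one more substitution, so \<open>Q\<close> may be given in terms of any other enumeration.
\<close>

lemma definable_vec_preimage:
  fixes X :: "(real ^ 'n) set"
  assumes "definable \<S> X" and Q: "\<And>j. definable_fun N (\<lambda>z. Q z $ j)"
  shows "{z \<in> Rn N. Q z \<in> X} \<in> \<S> N"
proof -
  obtain h where h: "bij_betw h {..<CARD('n)} (UNIV :: 'n set)" "coords h ` X \<in> \<S> CARD('n)"
    using assms(1) unfolding definable_coords by blast
  have "{z \<in> Rn N. (\<lambda>i\<in>{..<CARD('n)}. Q z $ h i) \<in> coords h ` X} \<in> \<S> N"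
    by (rule definable_preimage[OF h(2)]) (rule Q)
  then show ?thesis
    unfolding coords_def[symmetric] coords_mem_image_iff[OF h(1)] .
qed

lemma definable_fun_quadratic_map:
  fixes S :: "(nat \<Rightarrow> real) \<Rightarrow> real ^ 'n" and Q :: "(nat \<Rightarrow> real) \<Rightarrow> real ^ 'm"
  assumes "\<And>i. definable_fun N (\<lambda>z. S z $ i)" and "\<And>j. definable_fun N (\<lambda>z. Q z $ j)"
  shows "definable_fun N (\<lambda>z. quadratic_map p A x (S z) (Q z) $ i)"
proof -
  have "definable_fun N (\<lambda>z. p $ i + (\<Sum>j\<in>UNIV. A $ i $ j * (Q z $ j - x $ j)) +
      (\<Sum>j\<in>UNIV. (Q z $ j - x $ j) * (Q z $ j - x $ j)) * S z $ i)"
    by (intro definable_fun_add definable_fun_mult definable_fun_sum definable_fun_diff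
        definable_fun_const assms finite_class.finite_UNIV)
  then show ?thesis
    by (simp add: quadratic_map_def matrix_vector_mult_def inner_vec_def)
qed

lemma definable_map_quadratic_map:
  fixes M :: "(real ^ 'm) set" and s :: "real ^ 'n"
  assumes M: "definable \<S> M"
  shows "definable_map \<S> M (quadratic_map p A x s)"
proof -
  let ?f = "quadratic_map p A x s"
  let ?N = "CARD('m + 'n)"
  obtain h where h: "bij_betw h {..<?N} (UNIV :: ('m + 'n) set)"
    using ex_enumeration by blast
  define Q :: "(nat \<Rightarrow> real) \<Rightarrow> real ^ 'm" where "Q z = (\<chi> i. vec_of h z $ Inl i)" for z
  have vc: "definable_fun ?N (\<lambda>z. vec_of h z $ k)" for k
    unfolding vec_of_def using inv_enumeration_less[OF h]
    by (auto intro: definable_fun_coordinate)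
  then have Qc: "definable_fun ?N (\<lambda>z. Q z $ j)" for j by (simp add: Q_def)
  have "{z \<in> Rn ?N. Q z \<in> M} \<inter> {z \<in> Rn ?N. \<forall>j\<in>UNIV. vec_of h z $ Inr j = ?f (Q z) $ j} \<in> \<S> ?N"
    by (intro definable_Int definable_vec_preimage M Qc definable_Ball definable_eq vc
        definable_fun_quadratic_map definable_fun_const) simp
  moreover have "coords h ` (\<lambda>x. vec_join x (?f x)) ` M =
      {z \<in> Rn ?N. Q z \<in> M} \<inter> {z \<in> Rn ?N. \<forall>j\<in>UNIV. vec_of h z $ Inr j = ?f (Q z) $ j}"
  proof (intro equalityI subsetI)
    fix z assume "z \<in> coords h ` (\<lambda>x. vec_join x (?f x)) ` M"
    then obtain q where q: "q \<in> M" "z = coords h (vec_join q (?f q))" by blast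
    then have z: "vec_of h z = vec_join q (?f q)" using vec_of_coords[OF h] by blast
    then have "Q z = q" by (simp add: Q_def vec_join_def vec_eq_iff)
    moreover have "z \<in> Rn ?N" by (simp add: q(2) coords_def)
    ultimately show "z \<in> {z \<in> Rn ?N. Q z \<in> M} \<inter> {z \<in> Rn ?N. \<forall>j\<in>UNIV. vec_of h z $ Inr j = ?f (Q z) $ j}"
      using q(1) z by (simp add: vec_join_def)
  next
    fix z assume "z \<in> {z \<in> Rn ?N. Q z \<in> M} \<inter> {z \<in> Rn ?N. \<forall>j\<in>UNIV. vec_of h z $ Inr j = ?f (Q z) $ j}"
    then have z: "z \<in> Rn ?N" "Q z \<in> M" "\<And>j. vec_of h z $ Inr j = ?f (Q z) $ j" by auto
    have "vec_of h z $ Inl i = Q z $ i" for i by (simp add: Q_def)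
    then have "vec_of h z = vec_join (Q z) (?f (Q z))"
      unfolding vec_eq_iff vec_join_def vec_lambda_beta
      by (auto simp: z(3) split: sum.split)
    moreover have "z = coords h (vec_of h z)" unfolding coords_vec_of[OF h] using PiE_restrict[OF z(1)] by (rule sym)
    ultimately have "z = coords h (vec_join (Q z) (?f (Q z)))" by (simp only:)
    then show "z \<in> coords h ` (\<lambda>x. vec_join x (?f x)) ` M" using z(2) by blast
  qed
  ultimately have "coords h ` (\<lambda>x. vec_join x (?f x)) ` M \<in> \<S> ?N" by (simp only:)
  then show ?thesis unfolding definable_map_def definable_coords using h by blast
qed

end

section \<open>Transversality\<close>

text \<open>
  Parametric transversality for the quadratic family, away from \<open>x\<close>.  The set \<open>E X\<close> of all pairs
  \<open>(s, q)\<close> such that \<open>q\<close> lies in \<open>M\<close> and is mapped into \<open>X\<close> is definable.  Decompose the space of pairs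
  into cells compatible with all \<open>E X\<close>, and take \<open>s\<close> in an open cell of the projection.  If \<open>q\<close> is mapped
  into \<open>X\<close>, every line \<open>s + t w'\<close> lifts to a curve \<open>(s + t w', q\<^sub>t)\<close> in \<open>E X\<close> through
  \<open>(s, q)\<close>.  The image of \<open>q\<^sub>t\<close> under the map with parameter \<open>s + t w'\<close> is a
  curve in \<open>X\<close>.  Its velocity at \<open>0\<close> is the image of \<open>q\<^sub>0'\<close> under the differential at \<open>q\<close> plus \<open>\<bar>q - x\<bar>\<^sup>2 w'\<close>.  As \<open>w'\<close> is arbitrary, the tangent space of \<open>X\<close> and the image of the
  tangent space of \<open>M\<close> span everything.
\<close>

lemma generic_parameter:
  fixes M :: "(real ^ 'm) set" and \<Sigma> :: "(real ^ 'n) set set"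
  assumes "o_minimal_structure \<S>" and scd: "smooth_cell_decomposition \<S>"
    and M: "definable \<S> M" and \<Sigma>: "finite \<Sigma>" "\<And>X. X \<in> \<Sigma> \<Longrightarrow> definable \<S> X"
  obtains s :: "real ^ 'n" where
    "\<And>X q w. \<lbrakk>X \<in> \<Sigma>; q \<in> M; q \<noteq> x; quadratic_map p A x s q \<in> X\<rbrakk> \<Longrightarrow>
       \<exists>u\<in>tangent_space M q. \<exists>v\<in>tangent_space X (quadratic_map p A x s q).
         w = A *v u + (2 * ((q - x) \<bullet> u)) *\<^sub>R s + v"
proof -
  interpret o_minimal_structure \<S> by fact
  let ?n = "CARD('n)" and ?m = "CARD('m)"
  let ?N = "?n + ?m"
  obtain e where e: "bij_betw e {..<?n} (UNIV :: 'n set)" using ex_enumeration by blast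
  obtain k where k: "bij_betw k {..<?m} (UNIV :: 'm set)" using ex_enumeration by blast
  define S :: "(nat \<Rightarrow> real) \<Rightarrow> real ^ 'n" where "S z = vec_of e z" for z
  define Q :: "(nat \<Rightarrow> real) \<Rightarrow> real ^ 'm" where "Q z = vec_of k (\<lambda>i. z (?n + i))" for z
  have Sc: "definable_fun ?N (\<lambda>z. S z $ i)" for i
    using inv_enumeration_less[OF e, of i] by (auto simp: S_def vec_of_def intro!: definable_fun_coordinate)
  have Qc: "definable_fun ?N (\<lambda>z. Q z $ j)" for j
    using inv_enumeration_less[OF k, of j] by (auto simp: Q_def vec_of_def intro!: definable_fun_coordinate)
  define E where "E X = {z \<in> Rn ?N. Q z \<in> M} \<inter> {z \<in> Rn ?N. quadratic_map p A x (S z) (Q z) \<in> X}" for X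
  have "E ` \<Sigma> \<subseteq> \<S> ?N"
    unfolding E_def using \<Sigma>(2)
    by (auto intro!: definable_Int definable_vec_preimage M Qc Sc definable_fun_quadratic_map)
  then obtain \<D> where D: "smooth_decomposition \<S> ?N \<D>" "\<And>X C. X \<in> \<Sigma> \<Longrightarrow> C \<in> \<D> \<Longrightarrow> C \<subseteq> E X \<or> C \<inter> E X = {}"
    using scd \<Sigma>(1) unfolding smooth_cell_decomposition_def by (metis finite_imageI imageI)
  have D': "smooth_decomposition \<S> ?n ((`) (\<lambda>x. restrict x {..<?n}) ` \<D>)"
    by (rule smooth_decomposition_project[OF D(1)]) simp
  obtain B where B: "B \<in> (`) (\<lambda>x. restrict x {..<?n}) ` \<D>" "openin (top_of_set (Rn ?n)) B"
    using smooth_decomposition_open_cell[OF D'] by blast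
  obtain b where b: "b \<in> B"
    using partition_onD3[OF smooth_decomposition_partition(2)[OF D']] B(1) by (metis ex_in_conv)
  have bR: "b \<in> Rn ?n" using b B(2) openin_imp_subset by blast
  define s :: "real ^ 'n" where "s = vec_of e b"
  show thesis
  proof (rule that[of s])
    fix X and q :: "real ^ 'm" and w :: "real ^ 'n"
    assume X: "X \<in> \<Sigma>" and q: "q \<in> M" "q \<noteq> x" and fX: "quadratic_map p A x s q \<in> X"
    \<comment> \<open>The point \<open>(s, q)\<close> in coordinates.\<close>
    define z where "z = (\<lambda>i\<in>{..<?N}. if i < ?n then b i else q $ k (i - ?n))"
    have Sz: "S z = s"
      using inv_enumeration_less[OF e] by (simp add: S_def s_def vec_of_def vec_eq_iff z_def trans_less_add1)
    have Qz: "Q z = q"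
      using inv_enumeration_less[OF k]
      by (simp add: Q_def vec_of_def vec_eq_iff z_def bij_betw_inv_into_right[OF k])
    have zR: "z \<in> Rn ?N" by (simp add: z_def)
    have zE: "z \<in> E X" using zR q fX by (simp add: E_def Sz Qz)
    have zb: "restrict z {..<?n} = b"
    proof
      fix i show "restrict z {..<?n} i = b i"
        using Rn_undefined[OF bR, of i] by (cases "i < ?n") (auto simp: z_def)
    qed
    obtain C where C: "C \<in> \<D>" "z \<in> C"
      using partition_onD1[OF smooth_decomposition_partition(2)[OF D(1)]] zR by blast
    have CE: "C \<subseteq> E X" using D(2)[OF X C(1)] C(2) zE by blast
    have "(\<lambda>x. restrict x {..<?n}) ` C = B"
    proof (rule partition_on_unique[OF smooth_decomposition_partition(2)[OF D'] _ B(1) _ b])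
      show "b \<in> (\<lambda>x. restrict x {..<?n}) ` C" using zb C(2) by (metis image_eqI)
    qed (use C in blast)
    then have Copen: "openin (top_of_set (Rn ?n)) ((\<lambda>x. restrict x {..<?n}) ` C)" using B(2) by argo
    define r where "r = (q - x) \<bullet> (q - x)"
    have r: "r > 0" using q(2) by (simp add: r_def)
    \<comment> \<open>The parameter enters the map with the factor \<open>r\<close>.\<close>
    define w' where "w' = (1 / r) *\<^sub>R w"
    have "lifts_line ?n ?N C z (\<lambda>i. w' $ e i)"
      by (rule smooth_cell_lifts_line[OF smooth_decomposition_partition(3)[OF D(1) C(1)] _ C(2) Copen]) simp
    then obtain \<epsilon> \<gamma> \<gamma>' where eps: "0 < \<epsilon>" and \<gamma>0: "\<gamma> 0 = z"
      and \<gamma>: "\<And>t. t \<in> {-\<epsilon><..<\<epsilon>} \<Longrightarrow> \<gamma> t \<in> C"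
        "\<And>t i. t \<in> {-\<epsilon><..<\<epsilon>} \<Longrightarrow> i < ?n \<Longrightarrow> \<gamma> t i = z i + t * w' $ e i"
        "\<And>t i. t \<in> {-\<epsilon><..<\<epsilon>} \<Longrightarrow> i < ?N \<Longrightarrow> ((\<lambda>t. \<gamma> t i) has_real_derivative \<gamma>' i t) (at t)"
      and \<gamma>': "\<And>i. i < ?N \<Longrightarrow> continuous_on {-\<epsilon><..<\<epsilon>} (\<gamma>' i)"
      unfolding lifts_line_def by blast
    let ?I = "{-\<epsilon><..<\<epsilon>}"
    have S\<gamma>: "S (\<gamma> t) = s + t *\<^sub>R w'" if t: "t \<in> ?I" for t
    proof -
      have "S (\<gamma> t) $ j = (S z + t *\<^sub>R w') $ j" for j
        using \<gamma>(2)[OF t inv_enumeration_less[OF e, of j]]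
        by (simp add: S_def vec_of_def bij_betw_inv_into_right[OF e])
      then show ?thesis by (simp add: vec_eq_iff Sz)
    qed
    define Q' where "Q' t = (\<chi> j. \<gamma>' (?n + inv_into {..<?m} k j) t)" for t
    have Q': "((\<lambda>t. Q (\<gamma> t)) has_vector_derivative Q' t) (at t)" if "t \<in> ?I" for t
      by (rule has_vector_derivative_vec)
        (use \<gamma>(3)[OF that] inv_enumeration_less[OF k] in \<open>simp add: Q_def Q'_def vec_of_def\<close>)
    have Q'cont: "continuous_on ?I Q'"
      unfolding Q'_def using inv_enumeration_less[OF k] by (intro continuous_on_vec_lambda \<gamma>') simp
    have Qcont: "continuous_on ?I (\<lambda>t. Q (\<gamma> t))"
      using has_vector_derivative_continuous[OF Q'] by (simp add: continuous_at_imp_continuous_on)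
    have inE: "Q (\<gamma> t) \<in> M" "quadratic_map p A x (s + t *\<^sub>R w') (Q (\<gamma> t)) \<in> X" if "t \<in> ?I" for t
      using \<gamma>(1)[OF that] CE S\<gamma>[OF that] by (auto simp: E_def)
    define y' where "y' t = A *v Q' t + (2 * ((Q (\<gamma> t) - x) \<bullet> Q' t)) *\<^sub>R (s + t *\<^sub>R w') +
        ((Q (\<gamma> t) - x) \<bullet> (Q (\<gamma> t) - x)) *\<^sub>R w'" for t
    have "Q' 0 \<in> tangent_space M (Q (\<gamma> 0))"
      by (rule tangent_spaceI[OF eps Q' Q'cont inE(1)])
    then have u: "- Q' 0 \<in> tangent_space M q" by (simp add: tangent_space_minus \<gamma>0 Qz)
    have "y' 0 \<in> tangent_space X (quadratic_map p A x (s + 0 *\<^sub>R w') (Q (\<gamma> 0)))"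
    proof (rule tangent_spaceI[OF eps _ _ inE(2)])
      show "((\<lambda>t. quadratic_map p A x (s + t *\<^sub>R w') (Q (\<gamma> t))) has_vector_derivative y' t) (at t)"
        if "t \<in> ?I" for t
        unfolding y'_def by (rule quadratic_family_derivative[OF Q'[OF that]])
      have "continuous_on ?I (\<lambda>t. A *v Q' t)"
        by (rule bounded_linear.continuous_on[OF matrix_vector_mul_bounded_linear Q'cont])
      then show "continuous_on ?I y'"
        unfolding y'_def by (intro continuous_intros Q'cont Qcont)
    qed
    then have v: "y' 0 \<in> tangent_space X (quadratic_map p A x s q)" by (simp add: \<gamma>0 Qz)
    have "w = r *\<^sub>R w'" using r by (simp add: w'_def)
    also have "\<dots> = A *v (- Q' 0) + (2 * ((q - x) \<bullet> (- Q' 0))) *\<^sub>R s + y' 0"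
      by (simp add: y'_def \<gamma>0 Qz r_def linear_neg[OF bounded_linear.linear[OF matrix_vector_mul_bounded_linear]])
    finally show "\<exists>u\<in>tangent_space M q. \<exists>v\<in>tangent_space X (quadratic_map p A x s q).
         w = A *v u + (2 * ((q - x) \<bullet> u)) *\<^sub>R s + v"
      using u v by blast
  qed
qed

theorem lemma5p1:
  fixes \<S> :: "nat \<Rightarrow> (nat \<Rightarrow> real) set set"
    and V :: "(real ^ 'n) set" and \<Sigma> :: "(real ^ 'n) set set"
    and p :: "real ^ 'n" and S H :: "(real ^ 'n) set"
    and M :: "(real ^ 'm) set" and d :: nat
  assumes "o_minimal_structure \<S>" and "exponential \<S>" and "smooth_cell_decomposition \<S>"
    and "definable \<S> V" and "definable_stratification \<S> V \<Sigma>"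
    and "p \<in> V" and "S \<in> \<Sigma>" and "p \<in> S"
    and "subspace H" and "{u + v | u v. u \<in> H \<and> v \<in> tangent_space S p} = UNIV"
    and "definable \<S> M" and "submanifold \<infinity> d M" and "M \<noteq> {}" and "dim H \<le> d"
  shows "\<exists>f :: real ^ 'm \<Rightarrow> real ^ 'n.
    definable_map \<S> M f \<and> smooth_on M f \<and> (\<forall>X\<in>\<Sigma>. transverse M f X) \<and>
    (\<exists>x\<in>M. f x = p \<and> differential_image M f x = H)"
proof -
  have \<Sigma>: "finite \<Sigma>" "partition_on V \<Sigma>" "\<And>X. X \<in> \<Sigma> \<Longrightarrow> definable \<S> X"
    using assms(5) by (auto simp: definable_stratification_def)
  obtain x where x: "x \<in> M" using assms(13) by blast
  have T: "subspace (tangent_space M x)" "dim (tangent_space M x) = d"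
    using tangent_space_submanifold[OF assms(12) _ x] by auto
  obtain g where g: "linear g" "g ` tangent_space M x = H"
    using linear_map_onto_subspace[OF T(1) assms(9)] T(2) assms(14) by metis
  define A where "A = matrix g"
  have A: "A *v u = g u" for u using fun_cong[OF matrix_vector_mul(2)[OF g(1)], of u] by (simp only: A_def)
  obtain s :: "real ^ 'n" where s: "\<And>X q w. \<lbrakk>X \<in> \<Sigma>; q \<in> M; q \<noteq> x; quadratic_map p A x s q \<in> X\<rbrakk> \<Longrightarrow>
       \<exists>u\<in>tangent_space M q. \<exists>v\<in>tangent_space X (quadratic_map p A x s q).
         w = A *v u + (2 * ((q - x) \<bullet> u)) *\<^sub>R s + v"
    using generic_parameter[OF assms(1,3,11) \<Sigma>(1,3), of x p A] by blast
  let ?f = "quadratic_map p A x s"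
  have image: "differential_image M ?f q = (\<lambda>u. A *v u + (2 * ((q - x) \<bullet> u)) *\<^sub>R s) ` tangent_space M q" for q
    by (rule differential_image_eq[OF quadratic_map_has_derivative])
  have fx: "?f x = p" by (simp add: quadratic_map_def)
  have image_x: "differential_image M ?f x = H" using g(2) by (simp add: image A)
  have "transverse M ?f X" if X: "X \<in> \<Sigma>" for X
    unfolding transverse_def
  proof (intro ballI disjCI)
    fix q assume q: "q \<in> M" and "\<not> {u + v | u v. u \<in> differential_image M ?f q \<and> v \<in> tangent_space X (?f q)} = UNIV"
    moreover have "{u + v | u v. u \<in> differential_image M ?f q \<and> v \<in> tangent_space X (?f q)} = UNIV"
      if fq: "?f q \<in> X"
    proof (cases "q = x")
      case True
      \<comment> \<open>At \<open>x\<close> the position of \<open>H\<close> is transverse to the only stratum through \<open>p\<close>.\<close>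
      have "X = S" using partition_on_unique[OF \<Sigma>(2) X assms(7)] fq assms(8) by (simp add: True fx)
      then show ?thesis using assms(10) by (simp add: True fx image_x)
    next
      case False
      show ?thesis
      proof (intro equalityI subsetI UNIV_I CollectI)
        fix w
        show "\<exists>u v. w = u + v \<and> u \<in> differential_image M ?f q \<and> v \<in> tangent_space X (?f q)"
          using s[OF X q False fq, of w] unfolding image by blast
      qed
    qed
    ultimately show "?f q \<notin> X" by blast
  qed
  moreover have "smooth_on M ?f"
    unfolding smooth_on_def using quadratic_map_Cp by (metis open_UNIV UNIV_I)
  moreover have "definable_map \<S> M ?f"
    using o_minimal_structure.definable_map_quadratic_map assms(1,11) by blast
  ultimately show ?thesis using x fx image_x by blast
qed

end
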